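(* Let $H$ be an infinite dimensional complex Hilbert space and let $T\in\mathcal{B}(H)$. Then the following are equivalent: (1) $T\in\mathcal{AM}^+(H)$, i.e. $T$ is positive and absolutely minimum attaining; (2) there exists a unique decomposition of $T$ of the form $T=\alpha I-K+F$, where $\alpha\ge 0$ is a real scalar, $K\in\mathcal{B}(H)$ is a positive compact operator with $\|K\|\le\alpha$, and $F\in\mathcal{B}(H)$ is a positive finite rank operator satisfying $KF=FK=0$. Moreover, for such $T$ with this decomposition: (a) $T$ is of first type whenever $N(K-F)$ is finite dimensional; (b) $T$ is of second type whenever $N(K-F)$ is infinite dimensional.
   Context: $\mathcal{B}(H)$ is the space of bounded linear operators on $H$ ($H$ is not assumed separable); $N(S)$ denotes the null space of $S$; $I$ is the identity. $T\in\mathcal{B}(H)$ is positive ($T\ge 0$) if $T=T^*$ and $\langle Tx,x\rangle\ge 0$ for all $x\in H$ (so the zero operator is positive). For a bounded operator $T:H_1\to H_2$ between complex Hilbert spaces, the minimum modulus is $m(T)=\inf\{\|Tx\|: x\in H_1,\ \|x\|=1\}$; $T$ is minimum attaining if there is $x_0\in H_1$ with $\|x_0\|=1$ and $\|Tx_0\|=m(T)$; $T$ is absolutely minimum attaining if the restriction $T|_M:M\to H_2$ is minimum attaining for every nonzero closed subspace $M$ of $H_1$. $\mathcal{AM}(H)$ is the set of absolutely minimum attaining $T\in\mathcal{B}(H)$, and $\mathcal{AM}^+(H)=\{T\in\mathcal{AM}(H):T\ge 0\}$. An operator $T\in\mathcal{AM}^+(H)$ is of first type if it has no eigenvalue of infinite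 multiplicity, and of second type if it has a unique eigenvalue of infinite multiplicity (multiplicity of $\lambda$ means $\dim N(T-\lambda I)$). *)

theory Defs
  imports "HOL-Analysis.Analysis" "HOL-Library.Nonpos_Ints"
begin

section \<open>Complex Hilbert spaces\<close>

class scaleC =
  fixes scaleC :: "complex \<Rightarrow> 'a \<Rightarrow> 'a"  (infixr "*\<^sub>C" 75)

class complex_vector = real_vector + scaleC +
  assumes scaleR_scaleC: "r *\<^sub>R x = complex_of_real r *\<^sub>C x"
    and scaleC_add_right: "a *\<^sub>C (x + y) = a *\<^sub>C x + a *\<^sub>C y"
    and scaleC_add_left: "(a + b) *\<^sub>C x = a *\<^sub>C x + b *\<^sub>C x"
    and scaleC_scaleC: "a *\<^sub>C (b *\<^sub>C x) = (a * b) *\<^sub>C x"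
    and scaleC_one: "1 *\<^sub>C x = x"

global_interpretation complex_vector:
  vector_space "scaleC :: complex \<Rightarrow> 'a \<Rightarrow> 'a::complex_vector"
  by unfold_locales
    (simp_all add: scaleC_add_right scaleC_add_left scaleC_scaleC scaleC_one)

text \<open>
  The inner product is linear in its first argument. Positive definiteness is contained in
  \<open>cinner_norm\<close>, as the norm of a \<^class>\<open>real_normed_vector\<close> vanishes only at \<open>0\<close>.
\<close>

class complex_inner = complex_vector + real_normed_vector +
  fixes cinner :: "'a \<Rightarrow> 'a \<Rightarrow> complex"
  assumes cinner_commute: "cinner x y = cnj (cinner y x)"
    and cinner_add_left: "cinner (x + y) z = cinner x z + cinner y z"
    and cinner_scaleC_left: "cinner (a *\<^sub>C x) y = a * cinner x y"
    and cinner_norm: "cinner x x = complex_of_real ((norm x)\<^sup>2)"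

class chilbert_space = complex_inner + complete_space

definition closed_csubspace :: "'a::chilbert_space set \<Rightarrow> bool" where
  "closed_csubspace M \<longleftrightarrow> complex_vector.subspace M \<and> closed M"

text \<open>For complex linear subspaces: having finite dimension over the complex numbers.\<close>

definition finite_cdim :: "'a::complex_vector set \<Rightarrow> bool" where
  "finite_cdim S \<longleftrightarrow> (\<exists>B. finite B \<and> complex_vector.span B = S)"


section \<open>Bounded operators\<close>

text \<open>
  Operators are functions satisfying \<open>bounded_clinear\<close>; the operator norm is \<^const>\<open>onorm\<close>.
\<close>

definition bounded_clinear :: "('a::chilbert_space \<Rightarrow> 'b::chilbert_space) \<Rightarrow> bool" where
  "bounded_clinear T \<longleftrightarrow> bounded_linear T \<and> (\<forall>c x. T (c *\<^sub>C x) = c *\<^sub>C T x)"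

definition null_space :: "('a::chilbert_space \<Rightarrow> 'b::chilbert_space) \<Rightarrow> 'a set" where
  "null_space T = {x. T x = 0}"

definition is_cadjoint ::
    "('a::chilbert_space \<Rightarrow> 'b::chilbert_space) \<Rightarrow> ('b \<Rightarrow> 'a) \<Rightarrow> bool" where
  "is_cadjoint T S \<longleftrightarrow> (\<forall>x y. cinner (T x) y = cinner x (S y))"

text \<open>The condition \<open>T = T\<^sup>*\<close> reads: \<open>T\<close> is an adjoint of itself.\<close>

definition positive_op :: "('a::chilbert_space \<Rightarrow> 'a) \<Rightarrow> bool" where
  "positive_op T \<longleftrightarrow>
     bounded_clinear T \<and> is_cadjoint T T \<and> (\<forall>x. cinner (T x) x \<in> \<real>\<^sub>\<ge>\<^sub>0)"

definition compact_op :: "('a::chilbert_space \<Rightarrow> 'b::chilbert_space) \<Rightarrow> bool" where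
  "compact_op T \<longleftrightarrow> bounded_clinear T \<and> compact (closure (T ` cball 0 1))"

definition finite_rank_op :: "('a::chilbert_space \<Rightarrow> 'b::chilbert_space) \<Rightarrow> bool" where
  "finite_rank_op T \<longleftrightarrow> bounded_clinear T \<and> finite_cdim (range T)"


section \<open>Absolutely minimum attaining operators\<close>

text \<open>
  The restriction of \<open>T\<close> to a subspace \<open>M\<close> is represented by the pair of \<open>M\<close> and \<open>T\<close>.
  \<open>min_modulus M T\<close> is meaningful for \<open>M \<noteq> {0}\<close> only, as otherwise the infimum is over the
  empty set.
\<close>

definition min_modulus ::
    "'a::chilbert_space set \<Rightarrow> ('a \<Rightarrow> 'b::chilbert_space) \<Rightarrow> real" where
  "min_modulus M T = (INF x \<in> {x \<in> M. norm x = 1}. norm (T x))"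

definition min_attaining ::
    "'a::chilbert_space set \<Rightarrow> ('a \<Rightarrow> 'b::chilbert_space) \<Rightarrow> bool" where
  "min_attaining M T \<longleftrightarrow> (\<exists>x\<^sub>0 \<in> M. norm x\<^sub>0 = 1 \<and> norm (T x\<^sub>0) = min_modulus M T)"

definition AM :: "('a::chilbert_space \<Rightarrow> 'b::chilbert_space) set" where
  "AM = {T. bounded_clinear T \<and>
            (\<forall>M. closed_csubspace M \<and> M \<noteq> {0} \<longrightarrow> min_attaining M T)}"

definition AM_plus :: "('a::chilbert_space \<Rightarrow> 'a) set" where
  "AM_plus = {T \<in> AM. positive_op T}"

definition eigenvalue :: "('a::chilbert_space \<Rightarrow> 'a) \<Rightarrow> complex \<Rightarrow> bool" where
  "eigenvalue T l \<longleftrightarrow> (\<exists>x. x \<noteq> 0 \<and> T x = l *\<^sub>C x)"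

definition inf_mult_eigenvalue :: "('a::chilbert_space \<Rightarrow> 'a) \<Rightarrow> complex \<Rightarrow> bool" where
  "inf_mult_eigenvalue T l \<longleftrightarrow>
     eigenvalue T l \<and> \<not> finite_cdim (null_space (\<lambda>x. T x - l *\<^sub>C x))"

definition first_type :: "('a::chilbert_space \<Rightarrow> 'a) \<Rightarrow> bool" where
  "first_type T \<longleftrightarrow> T \<in> AM_plus \<and> \<not> (\<exists>l. inf_mult_eigenvalue T l)"

definition second_type :: "('a::chilbert_space \<Rightarrow> 'a) \<Rightarrow> bool" where
  "second_type T \<longleftrightarrow> T \<in> AM_plus \<and> (\<exists>!l. inf_mult_eigenvalue T l)"

definition AM_decomposition ::
    "('a::chilbert_space \<Rightarrow> 'a) \<Rightarrow> real \<Rightarrow> ('a \<Rightarrow> 'a) \<Rightarrow> ('a \<Rightarrow> 'a) \<Rightarrow> bool" where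
  "AM_decomposition T \<alpha> K F \<longleftrightarrow>
     0 \<le> \<alpha> \<and>
     positive_op K \<and> compact_op K \<and> onorm K \<le> \<alpha> \<and>
     positive_op F \<and> finite_rank_op F \<and>
     (\<forall>x. K (F x) = 0) \<and> (\<forall>x. F (K x) = 0) \<and>
     (\<forall>x. T x = \<alpha> *\<^sub>R x - K x + F x)"

end

theory Submission
  imports Defs
begin

text \<open>
  For a positive operator that attains its minimum modulus on a closed invariant subspace, the
  minimiser is an eigenvector. Removing minimisers one after the other yields an increasing
  sequence of eigenvalues, whose limit is the scalar of the decomposition. The eigenvalues below
  the limit give the compact part. Those above it must be finite in number, since two orthogonal
  sequences of eigenvectors with eigenvalues separated by a gap can be mixed into a subspace on
  which the minimum is not attained.

  Conversely, if the minimum modulus on a subspace is below the scalar, the parallelogram law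
  applied to \<open>(norm (T x))\<^sup>2 - \<mu>\<^sup>2 * (norm x)\<^sup>2\<close> shows that minimising sequences have Cauchy
  subsequences; otherwise the minimum is attained on the null space of the finite rank part, or
  the subspace has finite dimension. Uniqueness holds because the eigenvectors span a dense
  subspace and each of them determines the values of both parts.
\<close>

section \<open>Complex inner product spaces\<close>

text \<open>The space may be nonseparable, so the increasing sequence of eigenvectors cannot be
  expected to exhaust anything: it may even miss most of the eigenspace of its own limit \<alpha>.
  The eigenvectors for \<alpha> outside the sequence are therefore split off separately, and only
  the orthogonal complement of both is shown to be finite dimensional. On that complement every
  eigenvalue exceeds \<alpha>; because the minimum there is attained, the smallest one exceeds
  \<alpha> by a definite amount, and this supplies the gap that the mixing argument needs. Infinite
  dimension fixes \<alpha>: changing it would alter \<open>K - F\<close> by a multiple of the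
  identity, which cannot be compact. In the converse, \<open>onorm K \<le> \<alpha>\<close> gives
  both the positivity of \<open>T\<close> and the bound \<open>K^2 \<le> \<alpha> K\<close>, so that
  \<open>T\<close> does not expand any vector of the null space of \<open>F\<close> by more than
  \<alpha>. The comparison of the minimum modulus with \<alpha> decides the method, since
  \<open>\<alpha>^2 - \<mu>^2\<close> is the coercivity constant of the quadratic form.\<close>

lemma cinner_scaleR_left: "cinner (r *\<^sub>R x) (y::'a::complex_inner) = of_real r * cinner x y"
  by (simp add: scaleR_scaleC cinner_scaleC_left)

lemma cinner_add_right: "cinner x (y + z) = cinner x y + cinner x (z::'a::complex_inner)"
  by (metis cinner_commute cinner_add_left complex_cnj_add)

lemma cinner_scaleC_right: "cinner x (a *\<^sub>C y) = cnj a * cinner x (y::'a::complex_inner)"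
  by (metis cinner_commute cinner_scaleC_left complex_cnj_mult)

lemma cinner_scaleR_right: "cinner x (r *\<^sub>R y) = of_real r * cinner x (y::'a::complex_inner)"
  by (simp add: scaleR_scaleC cinner_scaleC_right)

lemma cinner_zero_left [simp]: "cinner 0 (y::'a::complex_inner) = 0"
  using cinner_scaleR_left[of 0 0 y] by simp

lemma cinner_zero_right [simp]: "cinner (y::'a::complex_inner) 0 = 0"
  using cinner_scaleR_right[of y 0 0] by simp

lemma cinner_minus_left: "cinner (- x) (y::'a::complex_inner) = - cinner x y"
  using cinner_scaleR_left[of "-1" x y] by simp

lemma cinner_minus_right: "cinner y (- x) = - cinner y (x::'a::complex_inner)"
  using cinner_scaleR_right[of y "-1" x] by simp

lemma cinner_diff_left: "cinner (x - y) (z::'a::complex_inner) = cinner x z - cinner y z"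
  using cinner_add_left[of x "-y" z] by (simp add: cinner_minus_left)

lemma cinner_diff_right: "cinner z (x - y) = cinner z x - cinner z (y::'a::complex_inner)"
  using cinner_add_right[of z x "-y"] by (simp add: cinner_minus_right)

lemmas cinner_simps = cinner_add_left cinner_add_right cinner_diff_left cinner_diff_right
  cinner_scaleC_left cinner_scaleC_right cinner_scaleR_left cinner_scaleR_right
  cinner_minus_left cinner_minus_right

lemma cinner_sum_left: "cinner (sum f A) (y::'a::complex_inner) = (\<Sum>i\<in>A. cinner (f i) y)"
  by (induction A rule: infinite_finite_induct) (simp_all add: cinner_add_left)

lemma cinner_sum_right: "cinner (y::'a::complex_inner) (sum f A) = (\<Sum>i\<in>A. cinner y (f i))"
  by (induction A rule: infinite_finite_induct) (simp_all add: cinner_add_right)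

lemma norm_square_Re_cinner: "(norm x)\<^sup>2 = Re (cinner x (x::'a::complex_inner))"
  by (simp add: cinner_norm)

lemma cinner_self_eq_0 [simp]: "cinner x x = 0 \<longleftrightarrow> x = (0::'a::complex_inner)"
  by (simp add: cinner_norm)

lemma cinner_eq_0_sym: "cinner x y = 0 \<Longrightarrow> cinner y (x::'a::complex_inner) = 0"
  by (metis cinner_commute complex_cnj_zero)

lemma Re_cinner_commute: "Re (cinner x y) = Re (cinner y (x::'a::complex_inner))"
  by (subst cinner_commute) simp

lemma norm_add_square:
  "(norm (x + y))\<^sup>2 = (norm x)\<^sup>2 + 2 * Re (cinner x y) + (norm (y::'a::complex_inner))\<^sup>2"
  using Re_cinner_commute[of y x] by (simp add: norm_square_Re_cinner cinner_simps)

lemma norm_diff_square: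
  "(norm (x - y))\<^sup>2 = (norm x)\<^sup>2 - 2 * Re (cinner x y) + (norm (y::'a::complex_inner))\<^sup>2"
  using Re_cinner_commute[of y x] by (simp add: norm_square_Re_cinner cinner_simps)

lemma parallelogram_law:
  "(norm (x + y))\<^sup>2 + (norm (x - y))\<^sup>2 = 2 * (norm x)\<^sup>2 + 2 * (norm (y::'a::complex_inner))\<^sup>2"
  by (simp add: norm_add_square norm_diff_square)

lemma norm_scaleC: "norm (c *\<^sub>C x) = cmod c * norm (x::'a::complex_inner)"
proof -
  have "complex_of_real ((norm (c *\<^sub>C x))\<^sup>2) = of_real ((cmod c * norm x)\<^sup>2)"
    unfolding cinner_norm[symmetric] cinner_scaleC_left cinner_scaleC_right
    by (simp add: cinner_norm power_mult_distrib complex_norm_square mult_ac flip: of_real_power)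
  then show ?thesis
    by (simp only: of_real_eq_iff power2_eq_iff_nonneg mult_nonneg_nonneg norm_ge_zero)
qed

text \<open>The first-order condition at a minimum: a short step along \<open>- h\<close> makes the
  linear term dominate. It yields orthogonality in the projection theorem and the variation identity
  for minimisers.\<close>

lemma quadratic_nonneg_imp_linear_0:
  fixes h :: complex and q :: real
  assumes "\<And>c. 0 \<le> 2 * Re (cnj c * h) + (cmod c)\<^sup>2 * q"
  shows "h = 0"
proof (rule ccontr)
  assume "h \<noteq> 0"
  \<comment> \<open>This step size gives \<open>t * q < 2\<close> whatever the sign of
    \<open>q\<close>, hence a negative value at \<open>c = - t * h\<close> unless \<open>h\<close>
    vanishes.\<close>
  define t where "t = 1 / (\<bar>q\<bar> + 1)"
  have t: "t > 0" "t * q < 2"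
    by (simp_all add: t_def pos_divide_less_eq)
  have "Re (cnj (- of_real t * h) * h) = - t * (cmod h)\<^sup>2"
    unfolding cmod_power2 by (simp add: power2_eq_square algebra_simps)
  then have "0 \<le> t * (cmod h)\<^sup>2 * (t * q - 2)"
    using assms[of "- of_real t * h"] t
    by (simp add: norm_mult power_mult_distrib power2_eq_square algebra_simps)
  moreover have "t * (cmod h)\<^sup>2 > 0"
    using t \<open>h \<noteq> 0\<close> by simp
  ultimately show False
    using t by (simp add: zero_le_mult_iff)
qed

lemma norm_add_scaleC_square:
  "(norm (x + c *\<^sub>C y))\<^sup>2 =
    (norm x)\<^sup>2 + 2 * Re (cnj c * cinner x y) + (cmod c)\<^sup>2 * (norm (y::'a::complex_inner))\<^sup>2"
  by (simp add: norm_add_square cinner_scaleC_right norm_scaleC power_mult_distrib)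

lemma cinner_Cauchy_Schwarz: "cmod (cinner x y) \<le> norm x * norm (y::'a::complex_inner)"
proof (cases "y = 0")
  case False
  \<comment> \<open>The minimiser of \<open>norm (x + c y)\<close>: it removes the component of
    \<open>x\<close> along \<open>y\<close>.\<close>
  define c where "c = - cinner x y / of_real ((norm y)\<^sup>2)"
  have "Re (cnj c * cinner x y) = - (cmod (cinner x y))\<^sup>2 / (norm y)\<^sup>2"
    unfolding cmod_power2 by (simp add: c_def power2_eq_square add_divide_distrib diff_divide_distrib)
  moreover have "(cmod c)\<^sup>2 = (cmod (cinner x y))\<^sup>2 / ((norm y)\<^sup>2)\<^sup>2"
    by (simp add: c_def norm_divide power_divide norm_power)
  ultimately have "0 \<le> (norm x)\<^sup>2 - (cmod (cinner x y))\<^sup>2 / (norm y)\<^sup>2"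
    using zero_le_power2[of "norm (x + c *\<^sub>C y)"] False
    unfolding norm_add_scaleC_square by (simp add: power2_eq_square)
  then have "(cmod (cinner x y))\<^sup>2 \<le> (norm x * norm y)\<^sup>2"
    using False by (simp add: field_simps power_mult_distrib)
  then show ?thesis
    by (simp add: power2_le_iff_abs_le)
qed simp

lemma bounded_bilinear_cinner:
  "bounded_bilinear (cinner :: 'a::complex_inner \<Rightarrow> 'a \<Rightarrow> complex)"
proof
  show "\<exists>K. \<forall>(a::'a) b. norm (cinner a b) \<le> norm a * norm b * K"
    by (rule exI[of _ 1]) (simp add: cinner_Cauchy_Schwarz)
qed (simp_all add: cinner_simps scaleR_conv_of_real)

lemma bounded_bilinear_scaleC:
  "bounded_bilinear (scaleC :: complex \<Rightarrow> 'a::complex_inner \<Rightarrow> 'a)"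
proof
  show "\<exists>K. \<forall>a (b::'a). norm (a *\<^sub>C b) \<le> norm a * norm b * K"
    by (rule exI[of _ 1]) (simp add: norm_scaleC)
qed (simp_all add: scaleC_add_left scaleC_add_right scaleR_scaleC scaleC_scaleC scaleR_conv_of_real
      mult.commute)

lemmas continuous_on_cinner [continuous_intros] =
    bounded_bilinear.continuous_on[OF bounded_bilinear_cinner]
  and tendsto_cinner [tendsto_intros] = bounded_bilinear.tendsto[OF bounded_bilinear_cinner]
  and continuous_on_scaleC [continuous_intros] =
    bounded_bilinear.continuous_on[OF bounded_bilinear_scaleC]
  and tendsto_scaleC [tendsto_intros] = bounded_bilinear.tendsto[OF bounded_bilinear_scaleC]

text \<open>The form in which the parallelogram law delivers its estimates, for the projection
  theorem as well as for minimising sequences of an operator.\<close>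

lemma Cauchy_if_norm_diff_square_le:
  fixes w :: "nat \<Rightarrow> 'a::real_normed_vector"
  assumes le: "\<And>m n. (norm (w m - w n))\<^sup>2 \<le> b m + b n" and b: "b \<longlonglongrightarrow> 0"
  shows "Cauchy w"
proof (rule CauchyI)
  fix e :: real
  assume "e > 0"
  then have "\<forall>\<^sub>F n in sequentially. b n < e\<^sup>2 / 2"
    using b by (intro order_tendstoD(2)[OF b]) simp
  then obtain N where N: "\<And>n. n \<ge> N \<Longrightarrow> b n < e\<^sup>2 / 2"
    by (auto simp: eventually_sequentially)
  have "norm (w m - w n) < e" if "m \<ge> N" "n \<ge> N" for m n
  proof (rule power2_less_imp_less)
    show "(norm (w m - w n))\<^sup>2 < e\<^sup>2"
      using le[of m n] N[OF that(1)] N[OF that(2)] by linarith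
  qed (use \<open>e > 0\<close> in simp)
  then show "\<exists>M. \<forall>m\<ge>M. \<forall>n\<ge>M. norm (w m - w n) < e"
    by blast
qed

section \<open>Algebra of bounded complex linear operators\<close>

lemma bounded_clinear_bounded_linear: "bounded_clinear T \<Longrightarrow> bounded_linear T"
  and bounded_clinear_scaleC: "bounded_clinear T \<Longrightarrow> T (c *\<^sub>C x) = c *\<^sub>C T x"
  by (simp_all add: bounded_clinear_def)

lemmas bounded_clinear_linear = bounded_linear.linear[OF bounded_clinear_bounded_linear]

lemmas bounded_clinear_add = linear_add[OF bounded_clinear_linear]
  and bounded_clinear_diff = linear_diff[OF bounded_clinear_linear]
  and bounded_clinear_zero = linear_0[OF bounded_clinear_linear]
  and bounded_clinear_sum = linear_sum[OF bounded_clinear_linear]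
  and bounded_clinear_scaleR = linear_cmul[OF bounded_clinear_linear]
  and bounded_clinear_continuous_on =
    bounded_linear.continuous_on[OF bounded_clinear_bounded_linear]
  and bounded_clinear_tendsto = bounded_linear.tendsto[OF bounded_clinear_bounded_linear]

lemma scaleC_scaleR_commute: "c *\<^sub>C (r *\<^sub>R x) = r *\<^sub>R (c *\<^sub>C (x::'a::complex_vector))"
  by (simp add: scaleR_scaleC scaleC_scaleC mult.commute)

lemma scaleC_diff_right: "c *\<^sub>C (x - y) = c *\<^sub>C x - c *\<^sub>C (y::'a::complex_vector)"
  by (rule complex_vector.scale_right_diff_distrib)

lemma bounded_clinear_diff_op:
  "bounded_clinear S \<Longrightarrow> bounded_clinear T \<Longrightarrow> bounded_clinear (\<lambda>x. S x - T x)"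
  by (auto simp: bounded_clinear_def scaleC_diff_right intro: bounded_linear_sub)

lemma bounded_clinear_add_op:
  "bounded_clinear S \<Longrightarrow> bounded_clinear T \<Longrightarrow> bounded_clinear (\<lambda>x. S x + T x)"
  by (auto simp: bounded_clinear_def scaleC_add_right intro: bounded_linear_add)

lemma bounded_clinear_scaleR_id: "bounded_clinear (\<lambda>x. r *\<^sub>R x)"
  by (auto simp: bounded_clinear_def scaleC_scaleR_commute bounded_linear_scaleR_right)

lemma bounded_clinear_scaleC_id: "bounded_clinear (\<lambda>x. c *\<^sub>C x)"
  by (auto simp: bounded_clinear_def scaleC_scaleC mult.commute
      intro: bounded_bilinear.bounded_linear_right[OF bounded_bilinear_scaleC])

lemma bounded_clinear_zero_op: "bounded_clinear (\<lambda>x. 0)"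
  by (auto simp: bounded_clinear_def)

lemma bounded_clinear_sum_op:
  "(\<And>i. i \<in> I \<Longrightarrow> bounded_clinear (S i)) \<Longrightarrow> bounded_clinear (\<lambda>x. \<Sum>i\<in>I. S i x)"
  by (induction I rule: infinite_finite_induct)
    (auto intro: bounded_clinear_zero_op bounded_clinear_add_op)

lemma bounded_clinear_rank_one: "bounded_clinear (\<lambda>x. cinner x a *\<^sub>C b)"
proof -
  have "bounded_linear (\<lambda>x. cinner x a *\<^sub>C b)"
    by (rule bounded_linear_compose[OF
          bounded_bilinear.bounded_linear_left[OF bounded_bilinear_scaleC]
          bounded_bilinear.bounded_linear_left[OF bounded_bilinear_cinner]])
  then show ?thesis
    by (auto simp: bounded_clinear_def cinner_scaleC_left scaleC_scaleC)
qed

section \<open>Closed subspaces and orthogonal projection\<close>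

lemma closed_csubspaceD:
  assumes "closed_csubspace M"
  shows "0 \<in> M" "x \<in> M \<Longrightarrow> y \<in> M \<Longrightarrow> x + y \<in> M" "x \<in> M \<Longrightarrow> y \<in> M \<Longrightarrow> x - y \<in> M"
    "x \<in> M \<Longrightarrow> c *\<^sub>C x \<in> M" "x \<in> M \<Longrightarrow> r *\<^sub>R x \<in> M" "closed M"
    "(\<And>i. i \<in> I \<Longrightarrow> f i \<in> M) \<Longrightarrow> sum f I \<in> M"
  using assms unfolding closed_csubspace_def scaleR_scaleC
  by (auto intro: complex_vector.subspace_0 complex_vector.subspace_add
      complex_vector.subspace_diff complex_vector.subspace_scale complex_vector.subspace_sum)

lemma closed_csubspace_UNIV: "closed_csubspace UNIV"
  by (auto simp: closed_csubspace_def)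

lemma closed_csubspace_null_space:
  assumes "bounded_clinear T"
  shows "closed_csubspace (null_space T)"
proof -
  have "closed (null_space T)"
    unfolding null_space_def
    by (intro closed_Collect_eq continuous_on_const bounded_clinear_continuous_on[OF assms continuous_on_id])
  moreover have "complex_vector.subspace (null_space T)"
    by (rule complex_vector.subspaceI) (simp_all add: null_space_def bounded_clinear_add[OF assms]
        bounded_clinear_scaleC[OF assms] bounded_clinear_zero[OF assms])
  ultimately show ?thesis
    by (simp add: closed_csubspace_def)
qed

lemma closed_csubspace_Int:
  "closed_csubspace L \<Longrightarrow> closed_csubspace M \<Longrightarrow> closed_csubspace (L \<inter> M)"
  by (auto simp: closed_csubspace_def complex_vector.subspace_inter)

lemma closed_csubspace_orthogonal:
  "closed_csubspace {x. \<forall>s\<in>S. cinner x s = 0}"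
proof -
  have "closed (\<Inter>s\<in>S. {x. cinner x s = 0})"
    by (intro closed_INT ballI closed_Collect_eq continuous_intros)
  moreover have "(\<Inter>s\<in>S. {x. cinner x s = 0}) = {x. \<forall>s\<in>S. cinner x s = 0}"
    by auto
  ultimately show ?thesis
    unfolding closed_csubspace_def
    by (auto intro!: complex_vector.subspaceI simp: cinner_simps)
qed

lemma closed_csubspace_closure_span: "closed_csubspace (closure (complex_vector.span S))"
  unfolding closed_csubspace_def
proof (intro conjI complex_vector.subspaceI)
  show "0 \<in> closure (complex_vector.span S)"
    using closure_subset complex_vector.span_zero by blast
  fix x y c
  assume x: "x \<in> closure (complex_vector.span S)"
  then obtain f where f: "\<And>n. f n \<in> complex_vector.span S" "f \<longlonglongrightarrow> x"
    unfolding closure_sequential by blast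
  have "(\<lambda>n. c *\<^sub>C f n) \<longlonglongrightarrow> c *\<^sub>C x"
    by (intro tendsto_intros f)
  then show "c *\<^sub>C x \<in> closure (complex_vector.span S)"
    unfolding closure_sequential
    by (intro exI[of _ "\<lambda>n. c *\<^sub>C f n"] conjI allI complex_vector.span_scale f(1))
  assume "y \<in> closure (complex_vector.span S)"
  then obtain g where g: "\<And>n. g n \<in> complex_vector.span S" "g \<longlonglongrightarrow> y"
    unfolding closure_sequential by blast
  have "(\<lambda>n. f n + g n) \<longlonglongrightarrow> x + y"
    by (intro tendsto_intros f g)
  then show "x + y \<in> closure (complex_vector.span S)"
    unfolding closure_sequential
    by (intro exI[of _ "\<lambda>n. f n + g n"] conjI allI complex_vector.span_add f(1) g(1))
qed simp

lemma closure_span_superset: "S \<subseteq> closure (complex_vector.span (S::'a::chilbert_space set))"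
  using closure_subset complex_vector.span_superset by blast

lemma closure_span_minimal:
  "S \<subseteq> M \<Longrightarrow> closed_csubspace M \<Longrightarrow> closure (complex_vector.span S) \<subseteq> M"
  unfolding closed_csubspace_def by (intro closure_minimal complex_vector.span_minimal) auto

text \<open>Midpoints of near-minimisers of the distance stay in \<open>W\<close>, so the
  parallelogram law makes a minimising sequence Cauchy. The limit is the nearest point, and
  orthogonality is the first-order condition there.\<close>

lemma projection_theorem:
  fixes x :: "'a::chilbert_space"
  assumes W: "closed_csubspace W"
  obtains y where "y \<in> W" "\<And>w. w \<in> W \<Longrightarrow> cinner (x - y) w = 0"
proof -
  define d where "d = (INF w\<in>W. (norm (x - w))\<^sup>2)"
  have bdd: "bdd_below ((\<lambda>w. (norm (x - w))\<^sup>2) ` W)"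
    by (rule bdd_belowI[of _ 0]) auto
  have d_le: "d \<le> (norm (x - w))\<^sup>2" if "w \<in> W" for w
    unfolding d_def using bdd that by (rule cINF_lower)
  have "\<exists>w\<in>W. (norm (x - w))\<^sup>2 < d + 1 / real (Suc n)" for n
    using cINF_less_iff[OF _ bdd, of "d + 1 / real (Suc n)"] closed_csubspaceD(1)[OF W]
    unfolding d_def by auto
  then obtain w where w: "\<And>n. w n \<in> W" "\<And>n. (norm (x - w n))\<^sup>2 < d + 1 / real (Suc n)"
    by metis
  have "Cauchy w"
  proof (rule Cauchy_if_norm_diff_square_le)
    fix m n
    have "(1 / 2) *\<^sub>R (w m + w n) \<in> W"
      using W w by (intro closed_csubspaceD)
    then have "4 * d \<le> (norm (2 *\<^sub>R (x - (1 / 2) *\<^sub>R (w m + w n))))\<^sup>2"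
      using d_le by (simp only: norm_scaleR power_mult_distrib) simp
    also have "2 *\<^sub>R (x - (1 / 2) *\<^sub>R (w m + w n)) = (x - w n) + (x - w m)"
      by (simp add: algebra_simps scaleR_2)
    finally have "(norm ((x - w n) - (x - w m)))\<^sup>2 \<le> 2 / real (Suc m) + 2 / real (Suc n)"
      using parallelogram_law[of "x - w n" "x - w m"] w(2)[of m] w(2)[of n] by auto
    then show "(norm (w m - w n))\<^sup>2 \<le> 2 / real (Suc m) + 2 / real (Suc n)"
      by simp
  next
    show "(\<lambda>n. 2 / real (Suc n)) \<longlonglongrightarrow> 0"
      using tendsto_mult_right_zero[OF LIMSEQ_inverse_real_of_nat, of 2]
      by (simp add: divide_inverse)
  qed
  then obtain y where y: "w \<longlonglongrightarrow> y"
    by (auto simp: Cauchy_convergent_iff convergent_def)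
  have "y \<in> W"
    using closed_csubspaceD(6)[OF W] w(1) y by (rule closed_sequentially)
  moreover have "cinner (x - y) u = 0" if "u \<in> W" for u
  proof (rule quadratic_nonneg_imp_linear_0)
    fix c
    have lim: "(\<lambda>n. (norm (x - w n))\<^sup>2) \<longlonglongrightarrow> (norm (x - y))\<^sup>2"
      by (intro tendsto_intros y)
    have lim_d: "(\<lambda>n. d + 1 / real (Suc n)) \<longlonglongrightarrow> d"
      using tendsto_add[OF tendsto_const LIMSEQ_inverse_real_of_nat, of d]
      by (simp add: divide_inverse)
    have "(norm (x - y))\<^sup>2 \<le> d"
      using less_imp_le[OF w(2)] by (intro LIMSEQ_le[OF lim lim_d]) blast
    also have "d \<le> (norm (x - (y - c *\<^sub>C u)))\<^sup>2"
      using W \<open>y \<in> W\<close> that by (intro d_le closed_csubspaceD)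
    also have "x - (y - c *\<^sub>C u) = (x - y) + c *\<^sub>C u"
      by simp
    finally show "0 \<le> 2 * Re (cnj c * cinner (x - y) u) + (cmod c)\<^sup>2 * (norm u)\<^sup>2"
      by (simp only: norm_add_scaleC_square)
  qed
  ultimately show ?thesis
    by (rule that)
qed

text \<open>The residual of a projection onto the closed span is orthogonal to \<open>S\<close>,
  hence zero. This turns statements about orthogonal complements into density.\<close>

lemma closure_span_eq_UNIV:
  fixes S :: "'a::chilbert_space set"
  assumes "\<And>x. (\<And>s. s \<in> S \<Longrightarrow> cinner x s = 0) \<Longrightarrow> x = 0"
  shows "closure (complex_vector.span S) = UNIV"
proof -
  have "x \<in> closure (complex_vector.span S)" for x
  proof -
    obtain y where y: "y \<in> closure (complex_vector.span S)"
      "\<And>w. w \<in> closure (complex_vector.span S) \<Longrightarrow> cinner (x - y) w = 0"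
      using projection_theorem[OF closed_csubspace_closure_span] by metis
    have "x - y = 0"
      using y(2) closure_span_superset by (intro assms) blast
    with y show ?thesis by simp
  qed
  then show ?thesis by blast
qed

section \<open>Orthonormal sets and finite dimension\<close>

text \<open>A set rather than a family, so that coefficients are functions of the vectors
  themselves. For a sequence \<open>e\<close>, \<open>orthonormal (range e)\<close> has to be
  accompanied by \<open>inj e\<close>, because a constant sequence of one unit vector satisfies the
  former.\<close>

definition orthonormal :: "'a::complex_inner set \<Rightarrow> bool" where
  "orthonormal S \<longleftrightarrow> (\<forall>x\<in>S. \<forall>y\<in>S. cinner x y = (if x = y then 1 else 0))"

lemma orthonormalD:
  assumes "orthonormal S"
  shows "x \<in> S \<Longrightarrow> cinner x x = 1" "x \<in> S \<Longrightarrow> y \<in> S \<Longrightarrow> x \<noteq> y \<Longrightarrow> cinner x y = 0"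
    "x \<in> S \<Longrightarrow> norm x = 1"
proof -
  show *: "x \<in> S \<Longrightarrow> cinner x x = 1" and "x \<in> S \<Longrightarrow> y \<in> S \<Longrightarrow> x \<noteq> y \<Longrightarrow> cinner x y = 0"
    using assms by (auto simp: orthonormal_def)
  show "norm x = 1" if "x \<in> S"
    using norm_square_Re_cinner[of x] *[OF that] norm_ge_zero[of x]
    by (auto simp: power2_eq_1_iff simp del: norm_ge_zero)
qed

lemma orthonormal_subset: "orthonormal S \<Longrightarrow> R \<subseteq> S \<Longrightarrow> orthonormal R"
  unfolding orthonormal_def by blast

lemma orthonormal_insert:
  assumes "orthonormal S" "cinner x x = 1" "\<And>s. s \<in> S \<Longrightarrow> cinner x s = 0"
  shows "orthonormal (insert x S)"
  using assms by (auto simp: orthonormal_def intro: cinner_eq_0_sym)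

lemma cinner_sum_orthonormal:
  assumes "orthonormal S" "finite S" "a \<in> S"
  shows "cinner (\<Sum>s\<in>S. c s *\<^sub>C s) a = c a"
proof -
  have "cinner (\<Sum>s\<in>S. c s *\<^sub>C s) a = (\<Sum>s\<in>S. if s = a then c s else 0)"
    unfolding cinner_sum_left
    using assms by (intro sum.cong) (auto simp: cinner_scaleC_left orthonormal_def)
  then show ?thesis
    using assms by simp
qed

lemma cinner_diff_orthonormal_sum:
  assumes "orthonormal S" "finite S" "a \<in> S"
  shows "cinner (x - (\<Sum>s\<in>S. cinner x s *\<^sub>C s)) a = 0"
  by (simp add: cinner_diff_left cinner_sum_orthonormal[OF assms])

lemma orthonormal_span_expansion:
  assumes "orthonormal S" "finite S" "x \<in> complex_vector.span S"
  shows "x = (\<Sum>s\<in>S. cinner x s *\<^sub>C s)"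
proof -
  obtain u where "x = (\<Sum>s\<in>S. u s *\<^sub>C s)"
    using assms(3) complex_vector.span_finite[OF assms(2)] by auto
  then show ?thesis
    using cinner_sum_orthonormal[OF assms(1,2)] by (metis (no_types, lifting) sum.cong)
qed

lemma norm_sum_orthonormal_square:
  assumes "orthonormal S" "finite S"
  shows "(norm (\<Sum>s\<in>S. c s *\<^sub>C s))\<^sup>2 = (\<Sum>s\<in>S. (cmod (c s))\<^sup>2)"
proof -
  have "cinner (\<Sum>s\<in>S. c s *\<^sub>C s) (\<Sum>s\<in>S. c s *\<^sub>C s) = (\<Sum>s\<in>S. cnj (c s) * c s)"
    by (subst cinner_sum_right)
      (simp add: cinner_scaleC_right cinner_sum_orthonormal[OF assms] cong: sum.cong)
  also have "\<dots> = of_real (\<Sum>s\<in>S. (cmod (c s))\<^sup>2)"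
    unfolding of_real_sum by (simp only: complex_norm_square mult.commute)
  finally show ?thesis
    by (simp add: norm_square_Re_cinner)
qed

text \<open>Gram-Schmidt along a finite generating set; a generator that equals its projection
  \<open>p\<close> onto the span built so far is dropped.\<close>

lemma orthonormal_basis_exists:
  fixes S :: "'a::complex_inner set"
  assumes "finite_cdim S"
  obtains E where "finite E" "orthonormal E" "complex_vector.span E = S"
proof -
  have "\<exists>E. finite E \<and> orthonormal E \<and> complex_vector.span E = complex_vector.span B"
    if "finite B" for B :: "'a set"
    using that
  proof induction
    case empty
    show ?case by (rule exI[of _ "{}"]) (simp add: orthonormal_def)
  next
    case (insert b B)
    then obtain E where E: "finite E" "orthonormal E"
        "complex_vector.span E = complex_vector.span B"
      by blast
    define p where "p = (\<Sum>e\<in>E. cinner b e *\<^sub>C e)"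
    have p: "p \<in> complex_vector.span E"
      unfolding p_def
      by (intro complex_vector.span_sum complex_vector.span_scale complex_vector.span_base)
    have eq: "complex_vector.span (insert b B) = complex_vector.span (insert (b - p) E)"
      using complex_vector.eq_span_insert_eq[of b "b - p" E] p E(3)
      by (simp add: complex_vector.span_insert)
    show ?case
    proof (cases "b = p")
      case True
      then show ?thesis using E eq by auto
    next
      case False
      define f where "f = (1 / norm (b - p)) *\<^sub>R (b - p)"
      have "cinner f e = 0" if "e \<in> E" for e
        using cinner_diff_orthonormal_sum[OF E(2,1) that, of b]
        by (simp add: f_def cinner_scaleR_left p_def)
      moreover have "cinner f f = 1"
        using False
        by (simp add: f_def cinner_scaleR_left cinner_scaleR_right cinner_norm[of "b - p"]
            power2_eq_square)
      ultimately have "orthonormal (insert f E)"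
        using E by (intro orthonormal_insert)
      moreover have "complex_vector.span (insert f E) = complex_vector.span (insert (b - p) E)"
        unfolding complex_vector.span_eq
      proof (intro conjI insert_subsetI)
        show "f \<in> complex_vector.span (insert (b - p) E)"
          unfolding f_def scaleR_scaleC
          by (intro complex_vector.span_scale complex_vector.span_base) simp
        have "b - p = of_real (norm (b - p)) *\<^sub>C f"
          using False by (simp add: f_def flip: scaleR_scaleC)
        then show "b - p \<in> complex_vector.span (insert f E)"
          by (metis complex_vector.span_scale complex_vector.span_base insertI1)
      qed (auto intro: complex_vector.span_base)
      ultimately show ?thesis
        using E eq by (intro exI[of _ "insert f E"]) auto
    qed
  qed
  then show ?thesis
    using assms that unfolding finite_cdim_def by metis
qed

lemma compact_orthonormal_combinations:
  fixes E :: "'a::complex_inner set"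
  assumes "finite E"
  shows "compact {\<Sum>e\<in>E. c e *\<^sub>C e | c. \<forall>e\<in>E. cmod (c e) \<le> r}"
  using assms
proof induction
  case empty
  then show ?case by simp
next
  case (insert e E)
  let ?Q = "{\<Sum>e\<in>E. c e *\<^sub>C e | c. \<forall>e\<in>E. cmod (c e) \<le> r}"
  have "compact ((\<lambda>p. fst p *\<^sub>C e + snd p) ` (cball 0 r \<times> ?Q))"
    using insert.IH by (intro compact_continuous_image compact_Times continuous_intros) auto
  also have "(\<lambda>p. fst p *\<^sub>C e + snd p) ` (cball 0 r \<times> ?Q) =
      {\<Sum>e\<in>insert e E. c e *\<^sub>C e | c. \<forall>e\<in>insert e E. cmod (c e) \<le> r}" (is "_ = ?R")
  proof safe
    fix z :: complex and c :: "'a \<Rightarrow> complex"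
    assume z: "z \<in> cball 0 r" and c: "\<forall>e\<in>E. cmod (c e) \<le> r"
    have "(\<Sum>x\<in>E. (c(e := z)) x *\<^sub>C x) = (\<Sum>x\<in>E. c x *\<^sub>C x)"
      using insert.hyps by (intro sum.cong) auto
    then have "fst (z, \<Sum>x\<in>E. c x *\<^sub>C x) *\<^sub>C e + snd (z, \<Sum>x\<in>E. c x *\<^sub>C x) =
        (\<Sum>x\<in>insert e E. (c(e := z)) x *\<^sub>C x)"
      using insert.hyps by simp
    moreover have "\<forall>x\<in>insert e E. cmod ((c(e := z)) x) \<le> r"
      using z c by auto
    ultimately show "\<exists>d. fst (z, \<Sum>x\<in>E. c x *\<^sub>C x) *\<^sub>C e + snd (z, \<Sum>x\<in>E. c x *\<^sub>C x) =
        (\<Sum>x\<in>insert e E. d x *\<^sub>C x) \<and> (\<forall>x\<in>insert e E. cmod (d x) \<le> r)"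
      by blast
  next
    fix c :: "'a \<Rightarrow> complex"
    assume c: "\<forall>x\<in>insert e E. cmod (c x) \<le> r"
    then show "(\<Sum>x\<in>insert e E. c x *\<^sub>C x) \<in> (\<lambda>p. fst p *\<^sub>C e + snd p) ` (cball 0 r \<times> ?Q)"
      using insert.hyps by (intro image_eqI[of _ _ "(c e, \<Sum>x\<in>E. c x *\<^sub>C x)"]) auto
  qed
  finally show ?case .
qed

text \<open>By Cauchy-Schwarz the coordinates of a vector of norm at most \<open>r\<close> in an
  orthonormal basis are bounded by \<open>r\<close>. The compact set of all such coordinate choices
  is larger than the ball, which explains the sandwich form.\<close>

lemma finite_cdim_bounded_subset_compact:
  fixes S :: "'a::complex_inner set"
  assumes "finite_cdim S"
  obtains Q where "compact Q" "S \<inter> cball 0 r \<subseteq> Q" "Q \<subseteq> S"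
proof -
  obtain E where E: "finite E" "orthonormal E" "complex_vector.span E = S"
    using orthonormal_basis_exists[OF assms] .
  let ?Q = "{\<Sum>e\<in>E. c e *\<^sub>C e | c. \<forall>e\<in>E. cmod (c e) \<le> r}"
  have "x \<in> ?Q" if x: "x \<in> S" "norm x \<le> r" for x
  proof -
    have "cmod (cinner x e) \<le> r" if "e \<in> E" for e
      using cinner_Cauchy_Schwarz[of x e] orthonormalD(3)[OF E(2) that] x by simp
    then show ?thesis
      using orthonormal_span_expansion[OF E(2,1)] x E(3) by blast
  qed
  then have "S \<inter> cball 0 r \<subseteq> ?Q"
    by auto
  moreover have "(\<Sum>e\<in>E. c e *\<^sub>C e) \<in> complex_vector.span E" for c
    by (intro complex_vector.span_sum complex_vector.span_scale complex_vector.span_base)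
  then have "?Q \<subseteq> S"
    using E(3) by auto
  ultimately show ?thesis
    using compact_orthonormal_combinations[OF E(1)] that by blast
qed

section \<open>Compact operators\<close>

lemma compact_op_if_subset:
  assumes "bounded_clinear T" "compact Q" "T ` cball 0 1 \<subseteq> Q"
  shows "compact_op T"
  unfolding compact_op_def
proof (intro conjI assms(1))
  have "closure (T ` cball 0 1) \<subseteq> Q"
    using assms by (intro closure_minimal compact_imp_closed)
  then show "compact (closure (T ` cball 0 1))"
    using compact_Int_closed[OF assms(2) closed_closure] by (metis inf.absorb2)
qed

lemma compact_op_bounded_clinear: "compact_op T \<Longrightarrow> bounded_clinear T"
  by (simp add: compact_op_def)

lemma compact_op_finite_rank:
  assumes "finite_rank_op T"
  shows "compact_op T"
proof -
  have T: "bounded_clinear T" "finite_cdim (range T)"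
    using assms by (auto simp: finite_rank_op_def)
  obtain Q where Q: "compact Q" "range T \<inter> cball 0 (onorm T) \<subseteq> Q"
    using finite_cdim_bounded_subset_compact[OF T(2)] by metis
  have "norm (T x) \<le> onorm T" if "norm x \<le> 1" for x
    using onorm[OF bounded_clinear_bounded_linear[OF T(1)], of x] that
      mult_left_mono[OF that onorm_pos_le[OF bounded_clinear_bounded_linear[OF T(1)]]]
    by (simp add: mult.commute)
  then have "T ` cball 0 1 \<subseteq> Q"
    using Q(2) by auto
  then show ?thesis
    using T(1) Q(1) by (intro compact_op_if_subset)
qed

lemma compact_op_diff:
  assumes "compact_op S" "compact_op T"
  shows "compact_op (\<lambda>x. S x - T x)"
proof -
  let ?S = "closure (S ` cball 0 1)" and ?T = "closure (T ` cball 0 1)"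
  have clin: "bounded_clinear (\<lambda>x. S x - T x)"
    using assms by (intro bounded_clinear_diff_op compact_op_bounded_clinear)
  have comp: "compact {x - y | x y. x \<in> ?S \<and> y \<in> ?T}"
    using assms by (intro compact_differences) (simp_all add: compact_op_def)
  have "S x - T x \<in> {x - y | x y. x \<in> ?S \<and> y \<in> ?T}" if x: "x \<in> cball 0 1" for x
  proof -
    have "S x \<in> ?S" "T x \<in> ?T"
      using imageI[OF x] closure_subset by (metis subsetD)+
    then show ?thesis
      by (metis (mono_tags, lifting) mem_Collect_eq)
  qed
  then have "(\<lambda>x. S x - T x) ` cball 0 1 \<subseteq> {x - y | x y. x \<in> ?S \<and> y \<in> ?T}"
    by (rule image_subsetI)
  with clin comp show ?thesis
    by (rule compact_op_if_subset)
qed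

text \<open>A finite net for the image of the ball under a good approximant \<open>S n\<close> is
  also a net for the image under \<open>K\<close>, with a slightly larger radius.\<close>

lemma compact_op_limit:
  fixes K :: "'a::chilbert_space \<Rightarrow> 'b::chilbert_space"
  assumes K: "bounded_clinear K" and "\<And>n. compact_op (S n)"
    and le: "\<And>n x. norm (K x - S n x) \<le> c n * norm x" and c: "c \<longlonglongrightarrow> 0"
  shows "compact_op K"
  unfolding compact_op_def compact_eq_totally_bounded
proof (intro conjI allI impI K)
  show "complete (closure (K ` cball 0 1))"
    by (simp add: complete_eq_closed)
  fix \<epsilon> :: real
  assume "\<epsilon> > 0"
  then obtain n where n: "\<bar>c n\<bar> < \<epsilon> / 4"
    using LIMSEQ_D[OF c, of "\<epsilon> / 4"] by auto
  obtain k where k: "finite k" "closure (S n ` cball 0 1) \<subseteq> (\<Union>z\<in>k. ball z (\<epsilon> / 4))"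
  proof -
    have "compact (closure (S n ` cball 0 1))"
      using assms(2)[of n] by (simp add: compact_op_def)
    moreover have "\<epsilon> / 4 > 0"
      using \<open>\<epsilon> > 0\<close> by simp
    ultimately show ?thesis
      using that unfolding compact_eq_totally_bounded by metis
  qed
  \<comment> \<open>Closed balls of radius \<open>\<epsilon> / 2\<close> survive the passage to the
    closure and still fit into the open balls of radius \<epsilon>.\<close>
  have "K x \<in> (\<Union>z\<in>k. cball z (\<epsilon> / 2))" if "norm x \<le> 1" for x
  proof -
    have "S n x \<in> closure (S n ` cball 0 1)"
      using that by (intro closure_subset[THEN subsetD] imageI) simp
    then obtain z where z: "z \<in> k" "dist z (S n x) < \<epsilon> / 4"
      using k(2) by auto
    have "c n * norm x \<le> \<epsilon> / 4"
      using n \<open>\<epsilon> > 0\<close> mult_mono[of "\<bar>c n\<bar>" "\<epsilon> / 4" "norm x" 1] that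
        mult_right_mono[OF abs_ge_self norm_ge_zero, of "c n" x] by simp
    then have "dist (S n x) (K x) \<le> \<epsilon> / 4"
      using le[of x n] by (simp add: dist_norm norm_minus_commute)
    then have "dist z (K x) \<le> \<epsilon> / 2"
      using dist_triangle[of z "K x" "S n x"] z(2) by simp
    with z(1) show ?thesis by auto
  qed
  then have "closure (K ` cball 0 1) \<subseteq> (\<Union>z\<in>k. cball z (\<epsilon> / 2))"
    using k(1) by (intro closure_minimal closed_UN) auto
  also have "\<dots> \<subseteq> (\<Union>z\<in>k. ball z \<epsilon>)"
    using \<open>\<epsilon> > 0\<close> by (intro UN_mono) auto
  finally show "\<exists>k. finite k \<and> closure (K ` cball 0 1) \<subseteq> (\<Union>z\<in>k. ball z \<epsilon>)"
    using k(1) by blast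
qed

lemma compact_op_convergent_subseq:
  assumes "compact_op C" "\<And>n. norm (x n) \<le> 1"
  obtains r :: "nat \<Rightarrow> nat" and l where "strict_mono r" "(\<lambda>n. C (x (r n))) \<longlonglongrightarrow> l"
proof -
  have "C (x n) \<in> closure (C ` cball 0 1)" for n
    using assms(2)[of n] by (intro closure_subset[THEN subsetD] imageI) simp
  moreover have "compact (closure (C ` cball 0 1))"
    using assms(1) by (simp add: compact_op_def)
  ultimately obtain l r where "strict_mono (r :: nat \<Rightarrow> nat)" "((\<lambda>n. C (x n)) \<circ> r) \<longlonglongrightarrow> l"
    by (metis compact_def)
  then show ?thesis
    using that by (simp add: o_def)
qed

lemma dist_orthonormal_sequence:
  fixes e :: "nat \<Rightarrow> 'a::complex_inner"
  assumes "orthonormal (range e)" "inj e" "m \<noteq> n"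
  shows "(norm (e m - e n))\<^sup>2 = 2"
  using orthonormalD[OF assms(1)] assms(2,3) by (simp add: norm_diff_square inj_eq)

text \<open>For \<open>c \<noteq> 0\<close> a convergent subsequence of \<open>C (e n)\<close>,
  divided by \<open>c\<close>, would be a convergent subsequence of \<open>e\<close>, whose members
  are pairwise at squared distance 2.\<close>

lemma compact_op_scalar_on_orthonormal_sequence:
  fixes e :: "nat \<Rightarrow> 'a::chilbert_space"
  assumes "compact_op C" "orthonormal (range e)" "inj e" "\<And>n. C (e n) = c *\<^sub>C e n"
  shows "c = 0"
proof (rule ccontr)
  assume "c \<noteq> 0"
  have "norm (e n) \<le> 1" for n
    using orthonormalD(3)[OF assms(2)] by simp
  then obtain r l where r: "strict_mono r" "(\<lambda>n. C (e (r n))) \<longlonglongrightarrow> l"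
    using compact_op_convergent_subseq[OF assms(1)] by blast
  have "(\<lambda>n. (1 / c) *\<^sub>C C (e (r n))) \<longlonglongrightarrow> (1 / c) *\<^sub>C l"
    by (intro tendsto_intros r)
  then have "Cauchy (\<lambda>n. e (r n))"
    using \<open>c \<noteq> 0\<close> by (simp add: assms(4) scaleC_scaleC scaleC_one LIMSEQ_imp_Cauchy)
  then obtain N where "norm (e (r (Suc N)) - e (r N)) < 1"
    by (metis CauchyD le_Suc_eq order_refl zero_less_one)
  then have "(norm (e (r (Suc N)) - e (r N)))\<^sup>2 < 1"
    by (simp add: power_less_one_iff)
  moreover have "r (Suc N) \<noteq> r N"
    using r(1) by (metis n_not_Suc_n strict_mono_eq)
  ultimately show False
    using dist_orthonormal_sequence[OF assms(2,3)] by simp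
qed

section \<open>Minimum attaining operators\<close>

lemma min_modulus_le:
  assumes "x \<in> M" "norm x = 1"
  shows "min_modulus M T \<le> norm (T x)"
  unfolding min_modulus_def using assms by (intro cINF_lower bdd_belowI[of _ 0]) auto

lemma min_modulus_mult_le:
  assumes T: "bounded_clinear T" and M: "closed_csubspace M" "x \<in> M"
  shows "min_modulus M T * norm x \<le> norm (T x)"
proof (cases "x = 0")
  case False
  have "min_modulus M T \<le> norm (T ((1 / norm x) *\<^sub>R x))"
    using M False by (intro min_modulus_le closed_csubspaceD) auto
  also have "\<dots> = norm (T x) / norm x"
    by (simp add: bounded_clinear_scaleR[OF T])
  finally show ?thesis
    using False by (simp add: field_simps)
qed simp

lemma unit_vector_exists:
  assumes "closed_csubspace M" "M \<noteq> {0}"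
  obtains x where "x \<in> M" "norm x = 1"
proof -
  obtain y where "y \<in> M" "y \<noteq> 0"
    using assms closed_csubspaceD(1)[OF assms(1)] by blast
  then show ?thesis
    using that[of "(1 / norm y) *\<^sub>R y"] closed_csubspaceD(5)[OF assms(1)] by simp
qed

lemma unit_sphere_nonempty:
  assumes "closed_csubspace M" "M \<noteq> {0}"
  shows "{x \<in> M. norm x = 1} \<noteq> {}"
proof -
  obtain x where "x \<in> M" "norm x = 1"
    by (rule unit_vector_exists[OF assms])
  then show ?thesis by blast
qed

lemma min_modulus_nonneg:
  assumes "closed_csubspace M" "M \<noteq> {0}"
  shows "0 \<le> min_modulus M T"
  unfolding min_modulus_def by (rule cINF_greatest[OF unit_sphere_nonempty[OF assms]]) simp

lemma min_attainingI:
  assumes "bounded_clinear T" "x \<in> M" "norm x = 1" "norm (T x) \<le> min_modulus M T"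
  shows "min_attaining M T"
  using assms min_modulus_le unfolding min_attaining_def by (metis antisym)

text \<open>First-order condition at a minimiser of \<open>norm (T x) / norm x\<close>.\<close>

lemma minimal_vector_variation:
  assumes T: "bounded_clinear T" and M: "closed_csubspace M"
    and le: "\<And>x. x \<in> M \<Longrightarrow> a * norm x \<le> norm (T x)" and "0 \<le> a"
    and v: "v \<in> M" "norm (T v) = a * norm v" and y: "y \<in> M"
  shows "cinner (T v) (T y) = of_real (a\<^sup>2) * cinner v y"
proof -
  have "cinner (T v) (T y) - of_real (a\<^sup>2) * cinner v y = 0"
  proof (rule quadratic_nonneg_imp_linear_0)
    fix c
    have "(a * norm (v + c *\<^sub>C y))\<^sup>2 \<le> (norm (T (v + c *\<^sub>C y)))\<^sup>2"
      using M v y \<open>0 \<le> a\<close> by (intro power_mono le closed_csubspaceD) auto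
    then show "0 \<le> 2 * Re (cnj c * (cinner (T v) (T y) - of_real (a\<^sup>2) * cinner v y))
        + (cmod c)\<^sup>2 * ((norm (T y))\<^sup>2 - a\<^sup>2 * (norm y)\<^sup>2)"
      by (simp add: bounded_clinear_add[OF T] bounded_clinear_scaleC[OF T] norm_add_scaleC_square
          power_mult_distrib v algebra_simps)
  qed
  then show ?thesis by simp
qed

section \<open>Minimisers of positive operators as eigenvectors\<close>

lemma positive_opD:
  assumes "positive_op T"
  shows "bounded_clinear T" "cinner (T x) y = cinner x (T y)" "0 \<le> Re (cinner (T x) x)"
  using assms by (auto simp: positive_op_def is_cadjoint_def complex_nonneg_Reals_iff)

text \<open>Self-adjointness already makes \<open>cinner (T x) x\<close> real, so only the sign of
  its real part remains to be checked.\<close>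

lemma positive_opI:
  assumes "bounded_clinear T" "\<And>x y. cinner (T x) y = cinner x (T y)"
    "\<And>x. 0 \<le> Re (cinner (T x) x)"
  shows "positive_op T"
proof -
  have "Im (cinner (T x) x) = 0" for x
    using assms(2)[of x x] cinner_commute[of x "T x"] by (metis Reals_cnj_iff complex_is_Real_iff)
  then show ?thesis
    using assms by (simp add: positive_op_def is_cadjoint_def complex_nonneg_Reals_iff)
qed

lemma AM_plusD:
  assumes "T \<in> AM_plus"
  shows "positive_op T" "closed_csubspace M \<Longrightarrow> M \<noteq> {0} \<Longrightarrow> min_attaining M T"
  using assms unfolding AM_plus_def AM_def by blast+

text \<open>The variation identity places \<open>T (T v) - a^2 v\<close> orthogonal to
  \<open>M\<close>, and invariance places it in \<open>M\<close>, so it is zero. Then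
  \<open>(T + a) (T - a) v = 0\<close>, and positivity of \<open>T\<close> lets the factor
  \<open>T + a\<close> be cancelled when \<open>a > 0\<close>.\<close>

lemma minimal_eigenvector:
  assumes T: "T \<in> AM_plus" and M: "closed_csubspace M" "M \<noteq> {0}"
    and inv: "T ` M \<subseteq> M"
  obtains v where "v \<in> M" "norm v = 1" "T v = norm (T v) *\<^sub>R v"
    "\<And>x. x \<in> M \<Longrightarrow> norm (T v) * norm x \<le> norm (T x)"
proof -
  note pos = positive_opD[OF AM_plusD(1)[OF T]]
  obtain v where v: "v \<in> M" "norm v = 1" "norm (T v) = min_modulus M T"
    using AM_plusD(2)[OF T M] by (auto simp: min_attaining_def)
  define a where "a = norm (T v)"
  have le: "a * norm x \<le> norm (T x)" if "x \<in> M" for x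
    using min_modulus_mult_le[OF pos(1) M(1) that] v by (simp add: a_def)
  have perp: "cinner (T (T v) - a\<^sup>2 *\<^sub>R v) y = 0" if "y \<in> M" for y
    using minimal_vector_variation[OF pos(1) M(1) le _ v(1) _ that] v
    by (simp add: a_def cinner_diff_left cinner_scaleR_left pos(2)[of "T v"] min_modulus_nonneg[OF M])
  then have "cinner (T (T v) - a\<^sup>2 *\<^sub>R v) (T (T v) - a\<^sup>2 *\<^sub>R v) = 0"
    using M(1) v(1) by (intro perp closed_csubspaceD inv[THEN image_subset_iff[THEN iffD1], rule_format])
  then have TT: "T (T v) = a\<^sup>2 *\<^sub>R v"
    by simp
  have "T v = a *\<^sub>R v"
  proof (cases "a = 0")
    case True
    then show ?thesis by (simp add: a_def)
  next
    case False
    \<comment> \<open>If \<open>u\<close> were nonzero, it would be an eigenvector of the positive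
      operator \<open>T\<close> for the negative value \<open>- a\<close>.\<close>
    define u where "u = T v - a *\<^sub>R v"
    have "T u = - a *\<^sub>R u"
      by (simp add: u_def bounded_clinear_diff[OF pos(1)] bounded_clinear_scaleR[OF pos(1)] TT
          power2_eq_square algebra_simps)
    then have "0 \<le> - a * (norm u)\<^sup>2"
      using pos(3)[of u] by (simp add: cinner_scaleR_left cinner_minus_left norm_square_Re_cinner)
    moreover have "a > 0"
      using False by (simp add: a_def)
    ultimately have "u = 0"
      by (simp add: mult_le_0_iff)
    then show ?thesis by (simp add: u_def)
  qed
  then show ?thesis
    using that[OF v(1,2)] le by (simp add: a_def)
qed

text \<open>The orthogonal complement of all eigenvectors is invariant. If it were nonzero, it would
  contain a minimal eigenvector, which would be orthogonal to itself.\<close>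

lemma eigenvectors_total:
  assumes T: "T \<in> AM_plus"
  shows "closure (complex_vector.span {v. \<exists>a::real. T v = a *\<^sub>R v}) = UNIV" (is "closure (complex_vector.span ?X) = _")
proof (rule closure_span_eq_UNIV)
  note pos = positive_opD[OF AM_plusD(1)[OF T]]
  let ?M = "{x. \<forall>s\<in>?X. cinner x s = 0}"
  have "?M = {0}"
  proof (rule ccontr)
    assume M: "?M \<noteq> {0}"
    have inv: "T ` ?M \<subseteq> ?M"
      by (auto simp: pos(2) cinner_scaleR_right)
    obtain v where "v \<in> ?M" "norm v = 1" "T v = norm (T v) *\<^sub>R v"
      by (rule minimal_eigenvector[OF T closed_csubspace_orthogonal M inv])
    then have "cinner v v = 0" by blast
    with \<open>norm v = 1\<close> show False by auto
  qed
  then show "x = 0" if "\<And>s. s \<in> ?X \<Longrightarrow> cinner x s = 0" for x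
    using that by blast
qed

section \<open>Sequences of eigenvectors and the obstruction to a spectral gap\<close>

lemma orthonormal_imageI:
  fixes f :: "nat \<Rightarrow> 'a::complex_inner"
  assumes "\<And>i. i \<in> I \<Longrightarrow> norm (f i) = 1"
    and "\<And>i j. i \<in> I \<Longrightarrow> j \<in> I \<Longrightarrow> i < j \<Longrightarrow> cinner (f j) (f i) = 0"
  shows "orthonormal (f ` I)" "inj_on f I"
proof -
  have 1: "cinner (f i) (f i) = 1" if "i \<in> I" for i
    using assms(1)[OF that] by (simp add: cinner_norm)
  have 0: "cinner (f i) (f j) = 0" if "i \<in> I" "j \<in> I" "i \<noteq> j" for i j
    using assms(2) that by (metis cinner_eq_0_sym linorder_neqE_nat)
  show "orthonormal (f ` I)"
    unfolding orthonormal_def using 0 1 by fastforce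
  show "inj_on f I"
    using 0 1 by (metis inj_onI zero_neq_one)
qed

text \<open>Each \<open>e n\<close> is a minimiser on the part of \<open>L\<close> orthogonal to its
  predecessors. The premise \<open>no_basis\<close> keeps that part nonzero; it speaks of
  eigenvectors only, so that its failure hands over a finite eigenbasis of \<open>L\<close>. The
  last conclusion retains the minimality, from which the eigenvalues are seen to increase.\<close>

lemma eigenvector_sequence:
  fixes T :: "'a::chilbert_space \<Rightarrow> 'a"
  assumes T: "T \<in> AM_plus" and L: "closed_csubspace L"
    and inv: "T ` L \<subseteq> L"
    and no_basis: "\<And>E. finite E \<Longrightarrow> orthonormal E \<Longrightarrow> E \<subseteq> L \<Longrightarrow>
      (\<And>v. v \<in> E \<Longrightarrow> T v = norm (T v) *\<^sub>R v) \<Longrightarrow> complex_vector.span E \<noteq> L"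
  obtains e :: "nat \<Rightarrow> 'a" where "\<And>n. e n \<in> L" "orthonormal (range e)" "inj e"
    "\<And>n. T (e n) = norm (T (e n)) *\<^sub>R e n"
    "\<And>n x. x \<in> L \<Longrightarrow> (\<And>k. k < n \<Longrightarrow> cinner x (e k) = 0) \<Longrightarrow>
      norm (T (e n)) * norm x \<le> norm (T x)"
proof -
  note pos = positive_opD[OF AM_plusD(1)[OF T]]
  define P where "P = (\<lambda>(f :: nat \<Rightarrow> 'a) n v. v \<in> L \<and> norm v = 1 \<and> (\<forall>k<n. cinner v (f k) = 0) \<and>
    T v = norm (T v) *\<^sub>R v \<and>
    (\<forall>x\<in>L. (\<forall>k<n. cinner x (f k) = 0) \<longrightarrow> norm (T v) * norm x \<le> norm (T x)))"
  have "\<exists>f. \<forall>n. P f n (f n)"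
  \<comment> \<open>Every choice depends on all earlier ones, and \<open>P f n v\<close> inspects
    \<open>f\<close> only below \<open>n\<close>.\<close>
  proof (rule dependent_wellorder_choice)
    show "P f n v = P g n v" if "\<And>k. k < n \<Longrightarrow> f k = g k" for f g n v
      using that unfolding P_def by simp
    fix n :: nat and f :: "nat \<Rightarrow> 'a"
    assume "\<And>k. k < n \<Longrightarrow> P f k (f k)"
    then have f: "f k \<in> L" "norm (f k) = 1" "T (f k) = norm (T (f k)) *\<^sub>R f k"
        "j < k \<Longrightarrow> cinner (f k) (f j) = 0" if "k < n" for j k
      using that unfolding P_def by auto
    let ?E = "f ` {..<n}"
    let ?M = "L \<inter> {x. \<forall>s\<in>?E. cinner x s = 0}"
    have E: "finite ?E" "orthonormal ?E" "?E \<subseteq> L" "\<And>v. v \<in> ?E \<Longrightarrow> T v = norm (T v) *\<^sub>R v"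
      using f by (auto intro!: orthonormal_imageI)
    have M_nonzero: "?M \<noteq> {0}"
    proof
      assume M: "?M = {0}"
      have "complex_vector.span ?E = L"
      proof (intro equalityI subsetI)
        show "x \<in> L" if "x \<in> complex_vector.span ?E" for x
          using that E(3) L complex_vector.span_minimal unfolding closed_csubspace_def by blast
        fix x
        assume "x \<in> L"
        \<comment> \<open>The residual of \<open>x\<close> after projection onto the earlier vectors
          lies in \<open>?M\<close>, here assumed trivial.\<close>
        let ?p = "\<Sum>s\<in>?E. cinner x s *\<^sub>C s"
        have "x - ?p \<in> L"
          using \<open>x \<in> L\<close> E(3) by (intro closed_csubspaceD[OF L]) auto
        moreover have "cinner (x - ?p) s = 0" if "s \<in> ?E" for s
          using cinner_diff_orthonormal_sum[OF E(2,1) that] .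
        ultimately have "x - ?p \<in> {0}"
          unfolding M[symmetric] by blast
        then have "x = ?p"
          by simp
        also have "\<dots> \<in> complex_vector.span ?E"
          by (intro complex_vector.span_sum complex_vector.span_scale complex_vector.span_base)
        finally show "x \<in> complex_vector.span ?E" .
      qed
      with no_basis[OF E] show False by simp
    qed
    have "T x \<in> ?M" if "x \<in> ?M" for x
    proof -
      have "cinner (T x) s = 0" if "s \<in> ?E" for s
        using E(4)[OF that] \<open>x \<in> ?M\<close> that pos(2)[of x s]
        by (metis (mono_tags, lifting) Int_iff cinner_scaleR_right mem_Collect_eq mult_zero_right)
      then show ?thesis
        using that inv by blast
    qed
    then have M_inv: "T ` ?M \<subseteq> ?M"
      by (rule image_subsetI)
    note M_closed = closed_csubspace_Int[OF L closed_csubspace_orthogonal]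
    obtain v where "v \<in> ?M" "norm v = 1" "T v = norm (T v) *\<^sub>R v"
      "\<And>x. x \<in> ?M \<Longrightarrow> norm (T v) * norm x \<le> norm (T x)"
      by (rule minimal_eigenvector[OF T M_closed M_nonzero M_inv]) (rule that; blast)
    then have "P f n v"
      unfolding P_def by simp
    then show "\<exists>v. P f n v" ..
  qed
  then obtain e where e: "\<And>n. P e n (e n)"
    by blast
  have ortho: "orthonormal (e ` UNIV)" "inj_on e UNIV"
    using e unfolding P_def by (intro orthonormal_imageI; blast)+
  show ?thesis
    by (rule that[OF _ ortho]) (use e in \<open>auto simp: P_def\<close>)
qed

text \<open>The orthonormal sequence in \<open>V\<close> that contradicts compactness is produced by
  \<open>eigenvector_sequence\<close>, whence the operator \<open>T\<close> and the invariance of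
  \<open>V\<close>. Applied to the whole space it fixes the scalar of a decomposition, applied to
  eigenspaces it controls multiplicities.\<close>

lemma compact_op_scalar_on_infinite_dim:
  fixes T :: "'a::chilbert_space \<Rightarrow> 'a"
  assumes T: "T \<in> AM_plus" and V: "closed_csubspace V" "T ` V \<subseteq> V"
    and inf: "\<not> finite_cdim V" and C: "compact_op C" "\<And>x. x \<in> V \<Longrightarrow> C x = c *\<^sub>C x"
  shows "c = 0"
proof -
  have "complex_vector.span E \<noteq> V" if "finite E" for E
    using inf that unfolding finite_cdim_def by blast
  then obtain e :: "nat \<Rightarrow> 'a" where "\<And>n. e n \<in> V" "orthonormal (range e)" "inj e"
    using eigenvector_sequence[OF T V] by metis
  then show ?thesis
    using C(2) compact_op_scalar_on_orthonormal_sequence[OF C(1)] by blast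
qed

text \<open>
  Mixing \<open>e n\<close> and \<open>f n\<close> gives an orthonormal sequence \<open>g\<close> with orthogonal images, along
  which \<open>(norm (T (g n)))\<^sup>2\<close> decreases strictly to \<open>a\<^sup>2\<close>. The minimum modulus \<open>a\<close> of \<open>T\<close> on the
  closed span of \<open>g\<close> is then not attained.
\<close>

lemma no_separated_eigenvector_sequences:
  fixes T :: "'a::chilbert_space \<Rightarrow> 'a" and e f :: "nat \<Rightarrow> 'a"
  assumes T: "T \<in> AM_plus" and ab: "0 \<le> a" "a < b"
    and e: "orthonormal (range e)" "inj e" "\<And>n. T (e n) = l n *\<^sub>R e n" "\<And>n. 0 \<le> l n" "\<And>n. l n \<le> a"
    and f: "orthonormal (range f)" "inj f" "\<And>n. T (f n) = u n *\<^sub>R f n" "\<And>n. b \<le> u n"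
    and ef: "\<And>m n. cinner (e m) (f n) = 0"
  shows False
proof -
  note pos = positive_opD[OF AM_plusD(1)[OF T]]
  \<comment> \<open>The prescribed value of \<open>(norm (T (g n)))^2\<close>, beginning with
    \<open>b^2\<close> at \<open>n = 0\<close>. It lies between \<open>(l n)^2 \<le> a^2\<close> and
    \<open>(u n)^2 \<ge> b^2\<close>, so the weight \<open>t n\<close> in \<open>[0, 1]\<close> is
    obtained by solving \<open>(1 - t) * (l n)^2 + t * (u n)^2 = v n\<close>.\<close>
  define v where "v n = a\<^sup>2 + (b\<^sup>2 - a\<^sup>2) / real (Suc n)" for n
  define t where "t n = (v n - (l n)\<^sup>2) / ((u n)\<^sup>2 - (l n)\<^sup>2)" for n
  define g where "g n = sqrt (1 - t n) *\<^sub>R e n + sqrt (t n) *\<^sub>R f n" for n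
  have sq: "a\<^sup>2 < b\<^sup>2" "(l n)\<^sup>2 \<le> a\<^sup>2" "b\<^sup>2 \<le> (u n)\<^sup>2" for n
    using ab e(4,5)[of n] f(4)[of n] by (auto intro: power_mono power_strict_mono)
  have v: "a\<^sup>2 < v n" "v n \<le> b\<^sup>2" for n
  proof -
    show "a\<^sup>2 < v n"
      using sq(1) by (simp add: v_def)
    have "(b\<^sup>2 - a\<^sup>2) / real (Suc n) \<le> (b\<^sup>2 - a\<^sup>2) / 1"
      using sq(1) by (intro divide_left_mono) auto
    then show "v n \<le> b\<^sup>2"
      by (simp add: v_def)
  qed
  have t: "0 \<le> t n" "t n \<le> 1" "(1 - t n) * (l n)\<^sup>2 + t n * (u n)\<^sup>2 = v n" for n
  proof -
    have pos: "(u n)\<^sup>2 - (l n)\<^sup>2 > 0"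
      using sq(1) sq(2,3)[of n] by linarith
    show "0 \<le> t n" "t n \<le> 1"
      using pos v[of n] sq(2,3)[of n] unfolding t_def by (simp_all add: divide_simps)
    have "t n * ((u n)\<^sup>2 - (l n)\<^sup>2) = v n - (l n)\<^sup>2"
      using pos by (simp add: t_def)
    then show "(1 - t n) * (l n)\<^sup>2 + t n * (u n)\<^sup>2 = v n"
      by (simp add: algebra_simps)
  qed
  have cross: "cinner (e m) (e n) = (if m = n then 1 else 0)"
    "cinner (f m) (f n) = (if m = n then 1 else 0)" "cinner (f m) (e n) = 0" for m n
    using e(1,2) f(1,2) ef by (auto simp: orthonormal_def inj_eq intro: cinner_eq_0_sym)
  have gg: "cinner (g m) (g n) = (if m = n then 1 else 0)" for m n
    using t(1,2)[of n]
    by (auto simp: g_def cinner_add_left cinner_add_right cinner_scaleR_left cinner_scaleR_right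
        cross ef simp flip: of_real_mult of_real_add)
  have Tg: "T (g n) = (sqrt (1 - t n) * l n) *\<^sub>R e n + (sqrt (t n) * u n) *\<^sub>R f n" for n
    by (simp add: g_def bounded_clinear_add[OF pos(1)] bounded_clinear_scaleR[OF pos(1)] e f)
  have TgTg: "cinner (T (g m)) (T (g n)) = (if m = n then of_real (v n) else 0)" for m n
  proof -
    have "sqrt (1 - t n) * l n * (sqrt (1 - t n) * l n) + sqrt (t n) * u n * (sqrt (t n) * u n) = v n"
      using t[of n] by (simp add: power2_eq_square algebra_simps flip: real_sqrt_mult)
    then show ?thesis
      unfolding Tg
      by (auto simp: cinner_add_left cinner_add_right cinner_scaleR_left cinner_scaleR_right
        cross ef simp flip: of_real_mult of_real_add)
  qed
  define G where "G = closure (complex_vector.span (range g))"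
  have G: "closed_csubspace G"
    unfolding G_def by (rule closed_csubspace_closure_span)
  have gG: "g n \<in> G" for n
    unfolding G_def by (rule closure_span_superset[THEN subsetD]) simp
  have norm_g: "norm (g n) = 1" for n
    using norm_square_Re_cinner[of "g n"] gg[of n n] norm_ge_zero[of "g n"]
    by (auto simp: power2_eq_1_iff simp del: norm_ge_zero)
  have orth_g: "orthonormal (range g)"
    using norm_g gg by (intro orthonormal_imageI(1)) auto
  \<comment> \<open>Although \<open>G\<close> need not be invariant under \<open>T\<close>, the form
    \<open>cinner (T x) (T y)\<close> is diagonal on it: for each \<open>n\<close> the difference of
    the two sides is orthogonality to a fixed vector, which holds on every \<open>g m\<close> and
    hence on the closed span.\<close>
  have diag: "cinner (T x) (T (g n)) = of_real (v n) * cinner x (g n)" if "x \<in> G" for x n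
  proof -
    let ?s = "T (T (g n)) - v n *\<^sub>R g n"
    have "range g \<subseteq> {x. \<forall>s\<in>{?s}. cinner x s = 0}"
      using TgTg gg by (auto simp: cinner_diff_right cinner_scaleR_right simp flip: pos(2))
    then have "G \<subseteq> {x. \<forall>s\<in>{?s}. cinner x s = 0}"
      unfolding G_def by (intro closure_span_minimal closed_csubspace_orthogonal)
    then have "cinner x ?s = 0"
      using that by blast
    then show ?thesis
      by (simp add: cinner_diff_right cinner_scaleR_right pos(2))
  qed
  \<comment> \<open>Since each \<open>v n\<close> is above \<open>a^2\<close>, the diagonal form
    gives the lower bound on finite combinations; being a closed condition it extends to
    \<open>G\<close>.\<close>
  have "complex_vector.span (range g) \<subseteq> {x. a * norm x \<le> norm (T x)}"
  proof
    fix x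
    assume x: "x \<in> complex_vector.span (range g)"
    then have xG: "x \<in> G"
      unfolding G_def using closure_subset by blast
    obtain I c where I: "finite I" "I \<subseteq> range g" and x_eq: "x = (\<Sum>s\<in>I. c s *\<^sub>C s)"
      using x unfolding complex_vector.span_explicit by blast
    note oI = orthonormal_subset[OF orth_g I(2)]
    have coeff: "cinner x s = c s" if "s \<in> I" for s
      unfolding x_eq by (rule cinner_sum_orthonormal[OF oI I(1) that])
    have "a\<^sup>2 * (cmod (c s))\<^sup>2 \<le> Re (cnj (c s) * cinner (T x) (T s))" if "s \<in> I" for s
    proof -
      have "s \<in> range g"
        using I(2) that by (rule subsetD)
      then obtain n where n: "s = g n"
        by (rule imageE)
      have "cnj (c s) * cinner (T x) (T s) = of_real (v n * (cmod (c s))\<^sup>2)"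
        using diag[OF xG, of n] coeff[OF that]
        by (simp add: n complex_norm_square mult_ac del: of_real_power)
      then show ?thesis
        using v(1)[of n] by (simp add: mult_right_mono)
    qed
    then have "(\<Sum>s\<in>I. a\<^sup>2 * (cmod (c s))\<^sup>2) \<le> (\<Sum>s\<in>I. Re (cnj (c s) * cinner (T x) (T s)))"
      by (rule sum_mono)
    also have "\<dots> = Re (cinner (T x) (\<Sum>s\<in>I. c s *\<^sub>C T s))"
      by (simp add: cinner_sum_right cinner_scaleC_right)
    also have "(\<Sum>s\<in>I. c s *\<^sub>C T s) = T x"
      by (simp add: x_eq bounded_clinear_sum[OF pos(1)] bounded_clinear_scaleC[OF pos(1)])
    finally have "(\<Sum>s\<in>I. a\<^sup>2 * (cmod (c s))\<^sup>2) \<le> (norm (T x))\<^sup>2"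
      by (simp only: norm_square_Re_cinner)
    moreover have "(\<Sum>s\<in>I. a\<^sup>2 * (cmod (c s))\<^sup>2) = (a * norm x)\<^sup>2"
      unfolding power_mult_distrib x_eq norm_sum_orthonormal_square[OF oI I(1)] sum_distrib_left ..
    ultimately have "(a * norm x)\<^sup>2 \<le> (norm (T x))\<^sup>2"
      by simp
    then have "a * norm x \<le> norm (T x)"
      by (rule power2_le_imp_le) simp
    then show "x \<in> {x. a * norm x \<le> norm (T x)}" ..
  qed
  then have "G \<subseteq> {x. a * norm x \<le> norm (T x)}"
    unfolding G_def
    by (intro closure_minimal closed_Collect_le continuous_intros
        bounded_clinear_continuous_on[OF pos(1)])
  then have low: "a * norm x \<le> norm (T x)" if "x \<in> G" for x
    using that by blast
  have "G \<noteq> {0}"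
    using gG[of 0] norm_g[of 0] by auto
  then obtain x where x: "x \<in> G" "norm x = 1" "norm (T x) = min_modulus G T"
    using AM_plusD(2)[OF T G] by (auto simp: min_attaining_def)
  have "(norm (T x))\<^sup>2 \<le> v n" for n
  proof -
    have "norm (T x) \<le> norm (T (g n))"
      unfolding x(3) by (intro min_modulus_le gG norm_g)
    then have "(norm (T x))\<^sup>2 \<le> (norm (T (g n)))\<^sup>2"
      by (intro power_mono) auto
    also have "\<dots> = v n"
      by (simp add: norm_square_Re_cinner TgTg)
    finally show ?thesis .
  qed
  moreover have "v \<longlonglongrightarrow> a\<^sup>2"
    using tendsto_add[OF tendsto_const tendsto_mult_right_zero[OF LIMSEQ_inverse_real_of_nat], of "a\<^sup>2" "b\<^sup>2 - a\<^sup>2"]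
    unfolding v_def by (simp add: divide_inverse)
  ultimately have "(norm (T x))\<^sup>2 \<le> a\<^sup>2"
    by (intro LIMSEQ_le_const) auto
  then have "norm (T x) \<le> a"
    using ab(1) by (rule power2_le_imp_le)
  then have Tx: "norm (T x) = a * norm x"
    using low[OF x(1)] x(2) by simp
  \<comment> \<open>The variation identity at the minimiser \<open>x\<close> has the factor
    \<open>a^2\<close> where \<open>diag\<close> has \<open>v n > a^2\<close>. Both can hold only if
    \<open>x\<close> is orthogonal to \<open>g n\<close>.\<close>
  have "cinner (g n) x = 0" for n
  proof -
    have "of_real (v n - a\<^sup>2) * cinner x (g n) = 0"
      using minimal_vector_variation[OF pos(1) G low ab(1) x(1) Tx gG[of n]] diag[OF x(1), of n]
      by (simp add: algebra_simps)
    then show ?thesis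
      using v(1)[of n] by (auto simp: cinner_eq_0_sym simp del: of_real_diff)
  qed
  then have "G \<subseteq> {y. \<forall>s\<in>{x}. cinner y s = 0}"
    unfolding G_def by (intro closure_span_minimal closed_csubspace_orthogonal) auto
  then have "cinner x x = 0"
    using x(1) by blast
  with x(2) show False
    by auto
qed

section \<open>Existence of the decomposition\<close>

text \<open>A finite spectral sum, serving both as the finite rank part and as truncation of the
  compact part. Over an infinite \<open>E\<close> the sum is 0 by convention, so the compact part
  itself is not defined this way.\<close>

definition diag_op :: "'a::complex_inner set \<Rightarrow> ('a \<Rightarrow> real) \<Rightarrow> 'a \<Rightarrow> 'a" where
  "diag_op E \<gamma> x = (\<Sum>v\<in>E. (of_real (\<gamma> v) * cinner x v) *\<^sub>C v)"

lemma bounded_clinear_diag_op: "bounded_clinear (diag_op E \<gamma>)"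
proof -
  have "bounded_clinear (\<lambda>x. \<Sum>v\<in>E. cinner x v *\<^sub>C (of_real (\<gamma> v) *\<^sub>C v))"
    by (intro bounded_clinear_sum_op bounded_clinear_rank_one)
  moreover have "(\<lambda>x. \<Sum>v\<in>E. cinner x v *\<^sub>C (of_real (\<gamma> v) *\<^sub>C v)) = diag_op E \<gamma>"
    by (simp add: diag_op_def scaleC_scaleC mult.commute fun_eq_iff)
  ultimately show ?thesis by simp
qed

lemma diag_op_selfadjoint: "cinner (diag_op E \<gamma> x) y = cinner x (diag_op E \<gamma> y)"
proof -
  have "of_real (\<gamma> v) * cinner x v * cinner v y = cnj (of_real (\<gamma> v) * cinner y v) * cinner x v" for v
    using cinner_commute[of v y] by simp
  then show ?thesis
    unfolding diag_op_def cinner_sum_left cinner_sum_right cinner_scaleC_left cinner_scaleC_right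
    by (rule sum.cong[OF refl])
qed

lemma diag_op_eigenvector:
  assumes "orthonormal E" "finite E" "v \<in> E"
  shows "diag_op E \<gamma> v = \<gamma> v *\<^sub>R v"
proof -
  have "diag_op E \<gamma> v = (\<Sum>u\<in>E. if u = v then \<gamma> v *\<^sub>R v else 0)"
    unfolding diag_op_def using assms
    by (intro sum.cong) (auto simp: orthonormal_def scaleR_scaleC)
  then show ?thesis
    using assms by simp
qed

lemma diag_op_orthogonal: "(\<And>v. v \<in> E \<Longrightarrow> cinner x v = 0) \<Longrightarrow> diag_op E \<gamma> x = 0"
  by (simp add: diag_op_def)

lemma positive_diag_op:
  assumes "\<And>v. v \<in> E \<Longrightarrow> 0 \<le> \<gamma> v"
  shows "positive_op (diag_op E \<gamma>)"
proof (rule positive_opI[OF bounded_clinear_diag_op diag_op_selfadjoint])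
  fix x
  have "cinner (diag_op E \<gamma> x) x = (\<Sum>v\<in>E. of_real (\<gamma> v * (cmod (cinner x v))\<^sup>2))"
    unfolding diag_op_def cinner_sum_left
    by (intro sum.cong refl)
      (simp add: cinner_scaleC_left complex_norm_square cinner_commute[symmetric] mult_ac
        del: of_real_power)
  then show "0 \<le> Re (cinner (diag_op E \<gamma> x) x)"
    using assms by (simp add: sum_nonneg)
qed

lemma finite_rank_diag_op:
  assumes "orthonormal E" "finite E" "\<And>v. v \<in> E \<Longrightarrow> \<gamma> v \<noteq> 0"
  shows "finite_rank_op (diag_op E \<gamma>)"
proof -
  have "range (diag_op E \<gamma>) = complex_vector.span E"
  proof (intro equalityI subsetI)
    show "y \<in> complex_vector.span E" if "y \<in> range (diag_op E \<gamma>)" for y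
      using that unfolding diag_op_def
      by (auto intro!: complex_vector.span_sum complex_vector.span_scale intro: complex_vector.span_base)
    fix y
    assume "y \<in> complex_vector.span E"
    then have "y = (\<Sum>v\<in>E. cinner y v *\<^sub>C v)"
      by (rule orthonormal_span_expansion[OF assms(1,2)])
    \<comment> \<open>A preimage is found by dividing the coordinates by the nonzero eigenvalues;
      hence the range is the whole span and not just contained in it.\<close>
    also have "\<dots> = diag_op E \<gamma> (\<Sum>v\<in>E. (cinner y v / of_real (\<gamma> v)) *\<^sub>C v)"
      unfolding diag_op_def using assms
      by (intro sum.cong refl) (simp add: cinner_sum_orthonormal)
    finally show "y \<in> range (diag_op E \<gamma>)"
      by blast
  qed
  then show ?thesis
    using assms(2) bounded_clinear_diag_op unfolding finite_rank_op_def finite_cdim_def by metis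
qed

lemma compact_diag_op:
  fixes E :: "'a::chilbert_space set"
  assumes "orthonormal E" "finite E" "\<And>v. v \<in> E \<Longrightarrow> \<bar>\<gamma> v\<bar> \<le> C"
  shows "compact_op (diag_op E \<gamma>)"
proof (rule compact_op_if_subset)
  show "compact {\<Sum>e\<in>E. c e *\<^sub>C e | c. \<forall>e\<in>E. cmod (c e) \<le> C}"
    by (rule compact_orthonormal_combinations[OF assms(2)])
  have "cmod (of_real (\<gamma> v) * cinner x v) \<le> C" if "v \<in> E" "norm x \<le> 1" for v x
  proof -
    have "cmod (cinner x v) \<le> 1"
      using cinner_Cauchy_Schwarz[of x v] that(2) orthonormalD(3)[OF assms(1) that(1)] by simp
    then have "\<bar>\<gamma> v\<bar> * cmod (cinner x v) \<le> C * 1"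
      using assms(3)[OF that(1)] by (intro mult_mono) auto
    then show ?thesis
      by (simp add: norm_mult)
  qed
  then show "diag_op E \<gamma> ` cball 0 1 \<subseteq> {\<Sum>e\<in>E. c e *\<^sub>C e | c. \<forall>e\<in>E. cmod (c e) \<le> C}"
    unfolding diag_op_def
    by (auto intro!: exI[of _ "\<lambda>v. of_real (\<gamma> v) * cinner x v" for x])
qed (rule bounded_clinear_diag_op)

text \<open>On the span of \<open>B \<union> Y\<close> a vector is a finite combination from
  \<open>B\<close> plus an orthogonal vector killed by \<open>S\<close>, and both estimates follow
  from Pythagoras. They are closed conditions, so density finishes. This bounds operators known only
  through their action on a total set.\<close>

lemma diagonal_bounds:
  fixes S :: "'a::chilbert_space \<Rightarrow> 'a"
  assumes S: "bounded_clinear S" and B: "orthonormal B"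
    and eig: "\<And>v. v \<in> B \<Longrightarrow> S v = \<gamma> v *\<^sub>R v" and \<gamma>: "\<And>v. v \<in> B \<Longrightarrow> 0 \<le> \<gamma> v" "\<And>v. v \<in> B \<Longrightarrow> \<gamma> v \<le> C"
    and "0 \<le> C"
    and Y: "\<And>y. y \<in> Y \<Longrightarrow> S y = 0" "\<And>y v. y \<in> Y \<Longrightarrow> v \<in> B \<Longrightarrow> cinner y v = 0"
    and dense: "closure (complex_vector.span (B \<union> Y)) = UNIV"
  shows "norm (S x) \<le> C * norm x" and "0 \<le> Re (cinner (S x) x)"
proof -
  have main: "norm (S x) \<le> C * norm x \<and> 0 \<le> Re (cinner (S x) x)"
    if "x \<in> complex_vector.span (B \<union> Y)" for x
  proof -
    obtain u y where u: "u \<in> complex_vector.span B" and y: "y \<in> complex_vector.span Y"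
      and x: "x = u + y"
      using \<open>x \<in> complex_vector.span (B \<union> Y)\<close> unfolding complex_vector.span_Un by blast
    let ?N = "null_space S \<inter> {y. \<forall>v\<in>B. cinner y v = 0}"
    have "closed_csubspace ?N"
      by (intro closed_csubspace_Int closed_csubspace_null_space closed_csubspace_orthogonal S)
    moreover have "Y \<subseteq> ?N"
      using Y by (auto simp: null_space_def)
    ultimately have "complex_vector.span Y \<subseteq> ?N"
      unfolding closed_csubspace_def using complex_vector.span_minimal by blast
    then have y0: "S y = 0" "\<And>v. v \<in> B \<Longrightarrow> cinner y v = 0"
      using y by (auto simp: null_space_def)
    obtain I c where I: "finite I" "I \<subseteq> B" and u_eq: "u = (\<Sum>s\<in>I. c s *\<^sub>C s)"
      using u unfolding complex_vector.span_explicit by blast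
    note oI = orthonormal_subset[OF B I(2)]
    have IB: "s \<in> B" if "s \<in> I" for s
      using I(2) that by blast
    have coeff: "cinner x s = c s" if "s \<in> I" for s
      using cinner_sum_orthonormal[OF oI I(1) that] y0(2)[OF IB[OF that]]
      by (simp add: x u_eq cinner_add_left)
    have Sx: "S x = (\<Sum>s\<in>I. (of_real (\<gamma> s) * c s) *\<^sub>C s)"
    proof -
      have "S x = (\<Sum>s\<in>I. c s *\<^sub>C S s)"
        by (simp add: x bounded_clinear_add[OF S] y0 u_eq bounded_clinear_sum[OF S]
            bounded_clinear_scaleC[OF S])
      also have "\<dots> = (\<Sum>s\<in>I. (of_real (\<gamma> s) * c s) *\<^sub>C s)"
        using IB by (intro sum.cong) (simp_all add: eig scaleR_scaleC scaleC_scaleC mult.commute)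
      finally show ?thesis .
    qed
    have "(norm u)\<^sup>2 \<le> (norm x)\<^sup>2"
    proof -
      have "cinner u y = 0"
        unfolding u_eq cinner_sum_left
        by (intro sum.neutral ballI) (simp add: cinner_scaleC_left cinner_eq_0_sym y0(2) IB)
      then show ?thesis
        by (simp add: x norm_add_square)
    qed
    have "(norm (S x))\<^sup>2 = (\<Sum>s\<in>I. (\<gamma> s * cmod (c s))\<^sup>2)"
      unfolding Sx norm_sum_orthonormal_square[OF oI I(1)]
      by (simp add: norm_mult power_mult_distrib)
    also have "\<dots> \<le> (\<Sum>s\<in>I. C\<^sup>2 * (cmod (c s))\<^sup>2)"
      unfolding power_mult_distrib using \<gamma> IB
      by (intro sum_mono mult_right_mono power_mono) auto
    also have "\<dots> = C\<^sup>2 * (norm u)\<^sup>2"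
      unfolding u_eq norm_sum_orthonormal_square[OF oI I(1)] sum_distrib_left ..
    also have "\<dots> \<le> C\<^sup>2 * (norm x)\<^sup>2"
      by (intro mult_left_mono \<open>(norm u)\<^sup>2 \<le> (norm x)\<^sup>2\<close>) simp
    finally have "(norm (S x))\<^sup>2 \<le> (C * norm x)\<^sup>2"
      by (simp add: power_mult_distrib)
    then have "norm (S x) \<le> C * norm x"
      by (rule power2_le_imp_le) (simp add: \<open>0 \<le> C\<close>)
    moreover have "cinner (S x) x = (\<Sum>s\<in>I. of_real (\<gamma> s * (cmod (c s))\<^sup>2))"
      unfolding Sx cinner_sum_left
    proof (intro sum.cong refl)
      fix s
      assume "s \<in> I"
      then have "cinner s x = cnj (c s)"
        using coeff cinner_commute[of s x] by simp
      then show "cinner ((of_real (\<gamma> s) * c s) *\<^sub>C s) x = of_real (\<gamma> s * (cmod (c s))\<^sup>2)"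
        by (simp add: cinner_scaleC_left complex_norm_square del: of_real_power)
    qed
    then have "0 \<le> Re (cinner (S x) x)"
      using \<gamma>(1) IB by (simp add: sum_nonneg)
    ultimately show ?thesis ..
  qed
  have "complex_vector.span (B \<union> Y) \<subseteq>
      {x. norm (S x) \<le> C * norm x} \<inter> {x. 0 \<le> Re (cinner (S x) x)}"
    using main by blast
  moreover have "closed ({x. norm (S x) \<le> C * norm x} \<inter> {x. 0 \<le> Re (cinner (S x) x)})"
    by (intro closed_Int closed_Collect_le continuous_intros bounded_clinear_continuous_on[OF S])
  ultimately have "UNIV \<subseteq> {x. norm (S x) \<le> C * norm x} \<inter> {x. 0 \<le> Re (cinner (S x) x)}"
    unfolding dense[symmetric] by (rule closure_minimal)
  then show "norm (S x) \<le> C * norm x" and "0 \<le> Re (cinner (S x) x)"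
    by auto
qed

text \<open>The space is generated by the sequence \<open>e\<close>, the further
  \<alpha>-eigenvectors \<open>Z\<close> and the remainder \<open>M\<close>. \<open>F\<close>
  carries the excess of \<open>T\<close> over \<alpha> on \<open>M\<close>, and \<open>K\<close> its
  deficit on \<open>e\<close>.\<close>

lemma AM_decomposition_exists:
  fixes T :: "'a::chilbert_space \<Rightarrow> 'a"
  assumes inf: "\<not> finite_cdim (UNIV :: 'a set)" and T: "T \<in> AM_plus"
  shows "\<exists>\<alpha> K F. AM_decomposition T \<alpha> K F"
proof -
  note pos = positive_opD[OF AM_plusD(1)[OF T]]
  have "complex_vector.span E \<noteq> UNIV" if "finite E" for E :: "'a set"
    using inf that unfolding finite_cdim_def by blast
  then obtain e :: "nat \<Rightarrow> 'a" where e: "orthonormal (range e)" "inj e"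
    "\<And>n. T (e n) = norm (T (e n)) *\<^sub>R e n"
    "\<And>n x. (\<And>k. k < n \<Longrightarrow> cinner x (e k) = 0) \<Longrightarrow> norm (T (e n)) * norm x \<le> norm (T x)"
    using eigenvector_sequence[OF T closed_csubspace_UNIV] by (metis UNIV_I subset_UNIV)
  have e_norm: "norm (e n) = 1" for n
    using orthonormalD(3)[OF e(1)] by simp
  have e_orth: "cinner (e m) (e n) = 0" if "m \<noteq> n" for m n
    using orthonormalD(2)[OF e(1)] e(2) that by (simp add: inj_eq)
  define l where "l n = norm (T (e n))" for n
  have "incseq l"
  proof (rule incseq_SucI)
    show "l n \<le> l (Suc n)" for n
      using e(4)[of n "e (Suc n)"] e_orth e_norm by (simp add: l_def)
  qed
  moreover have "l n \<le> onorm T" for n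
    using onorm[OF bounded_clinear_bounded_linear[OF pos(1)], of "e n"] e_norm by (simp add: l_def)
  ultimately obtain \<alpha> where \<alpha>: "l \<longlonglongrightarrow> \<alpha>" "\<And>n. l n \<le> \<alpha>"
    using incseq_convergent by metis
  have l_nonneg: "0 \<le> l n" for n
    by (simp add: l_def)
  have "0 \<le> \<alpha>"
    using l_nonneg[of 0] \<alpha>(2)[of 0] by linarith

  \<comment> \<open>The part of the \<alpha>-eigenspace missed by \<open>e\<close>. Its dimension is
    unrestricted; both \<open>K\<close> and \<open>F\<close> vanish on it.\<close>
  define Z where "Z = {z. T z = \<alpha> *\<^sub>R z \<and> (\<forall>n. cinner z (e n) = 0)}"
  define M where "M = {x. \<forall>s\<in>range e \<union> Z. cinner x s = 0}"
  have M: "closed_csubspace M"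
    unfolding M_def by (rule closed_csubspace_orthogonal)
  have MD: "cinner x (e n) = 0" "z \<in> Z \<Longrightarrow> cinner x z = 0" if "x \<in> M" for x z n
    using that by (auto simp: M_def)
  have "cinner (T x) s = 0" if x: "x \<in> M" and s: "s \<in> range e \<union> Z" for x s
  proof -
    obtain c :: real where "T s = c *\<^sub>R s"
      using s e(3) by (auto simp: Z_def)
    then show ?thesis
      using x s by (simp add: pos(2) cinner_scaleR_right M_def)
  qed
  then have M_inv: "T ` M \<subseteq> M"
    by (auto simp: M_def)
  \<comment> \<open>A vector of \<open>M\<close> is orthogonal to all \<open>e k\<close>, so every
    \<open>l n\<close> is a lower bound, and so is their limit.\<close>
  have M_low: "\<alpha> * norm x \<le> norm (T x)" if "x \<in> M" for x
  proof (rule LIMSEQ_le_const2)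
    show "(\<lambda>n. l n * norm x) \<longlonglongrightarrow> \<alpha> * norm x"
      by (intro tendsto_intros \<alpha>)
    show "\<exists>N. \<forall>n\<ge>N. l n * norm x \<le> norm (T x)"
      using e(4) MD(1)[OF that] by (auto simp: l_def)
  qed
  have M_eig: "\<alpha> < norm (T v)" if "v \<in> M" "norm v = 1" "T v = norm (T v) *\<^sub>R v" for v
  proof (rule ccontr)
    assume "\<not> \<alpha> < norm (T v)"
    then have "norm (T v) = \<alpha>"
      using M_low[OF that(1)] that(2) by simp
    then have "v \<in> Z"
      using that MD(1) by (simp add: Z_def)
    then have "cinner v v = 0"
      using MD(2)[OF that(1)] by blast
    with that(2) show False
      by auto
  qed

  have "\<exists>E. finite E \<and> orthonormal E \<and> E \<subseteq> M \<and> (\<forall>v\<in>E. T v = norm (T v) *\<^sub>R v) \<and>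
    complex_vector.span E = M"
  proof (rule ccontr)
    assume "\<not> ?thesis"
    then have no_basis: "complex_vector.span E \<noteq> M"
      if "finite E" "orthonormal E" "E \<subseteq> M" "\<And>v. v \<in> E \<Longrightarrow> T v = norm (T v) *\<^sub>R v" for E
      using that by blast
    obtain f :: "nat \<Rightarrow> 'a" where f: "\<And>n. f n \<in> M" "orthonormal (range f)" "inj f"
      "\<And>n. T (f n) = norm (T (f n)) *\<^sub>R f n"
      "\<And>n x. x \<in> M \<Longrightarrow> (\<And>k. k < n \<Longrightarrow> cinner x (f k) = 0) \<Longrightarrow>
        norm (T (f n)) * norm x \<le> norm (T x)"
      using eigenvector_sequence[OF T M M_inv no_basis] by blast
    have f_norm: "norm (f n) = 1" for n
      using orthonormalD(3)[OF f(2)] by simp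
    show False
    proof (rule no_separated_eigenvector_sequences[OF T \<open>0 \<le> \<alpha>\<close> _ e(1,2) _ l_nonneg \<alpha>(2) f(2,3)])
      \<comment> \<open>The gap: \<open>f 0\<close> is a minimiser on \<open>M\<close>, so its
        eigenvalue is the least one there, yet still strictly above \<alpha>.\<close>
      show "\<alpha> < norm (T (f 0))"
        by (rule M_eig[OF f(1) f_norm f(4)])
      show "T (e n) = l n *\<^sub>R e n" for n
        unfolding l_def by (rule e(3))
      show "T (f n) = norm (T (f n)) *\<^sub>R f n" for n
        by (rule f(4))
      show "norm (T (f 0)) \<le> norm (T (f n))" for n
        using f(5)[OF f(1), of 0 n] f_norm by simp
      show "cinner (e m) (f n) = 0" for m n
        using MD(1)[OF f(1)] by (rule cinner_eq_0_sym)
    qed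
  qed
  then obtain E where E: "finite E" "orthonormal E" "E \<subseteq> M" "\<And>v. v \<in> E \<Longrightarrow> T v = norm (T v) *\<^sub>R v"
    "complex_vector.span E = M"
    by blast
  have E_gap: "0 < norm (T v) - \<alpha>" if "v \<in> E" for v
    using M_eig[OF _ orthonormalD(3)[OF E(2) that] E(4)[OF that]] E(3) that by auto

  define F where "F = diag_op E (\<lambda>v. norm (T v) - \<alpha>)"
  \<comment> \<open>Taken as the remainder, so that no infinite sum is needed. Its diagonal form is
    checked on \<open>e\<close>, \<open>Z\<close> and \<open>M\<close> instead.\<close>
  define K where "K x = \<alpha> *\<^sub>R x - T x + F x" for x
  have F_clin: "bounded_clinear F"
    unfolding F_def by (rule bounded_clinear_diag_op)
  have F_sa: "cinner (F x) y = cinner x (F y)" for x y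
    unfolding F_def by (rule diag_op_selfadjoint)
  have K_clin: "bounded_clinear K"
    unfolding K_def[abs_def]
    by (intro bounded_clinear_add_op bounded_clinear_diff_op bounded_clinear_scaleR_id pos(1) F_clin)
  have K_sa: "cinner (K x) y = cinner x (K y)" for x y
    by (simp add: K_def cinner_simps pos(2) F_sa)
  have F_0: "F x = 0" if "\<And>v. v \<in> E \<Longrightarrow> cinner x v = 0" for x
    unfolding F_def using that by (rule diag_op_orthogonal)
  have K_M: "K x = 0" if "x \<in> M" for x
  proof -
    have "K v = 0" if "v \<in> E" for v
    proof -
      have "F v = (norm (T v) - \<alpha>) *\<^sub>R v"
        unfolding F_def by (rule diag_op_eigenvector[OF E(2,1) that])
      then show ?thesis
        using E(4)[OF that] by (simp add: K_def algebra_simps)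
    qed
    then have "complex_vector.span E \<subseteq> null_space K"
      using closed_csubspace_null_space[OF K_clin]
      by (intro complex_vector.span_minimal) (auto simp: null_space_def closed_csubspace_def)
    then show ?thesis
      using that E(5) by (auto simp: null_space_def)
  qed
  have K_e: "K (e n) = (\<alpha> - l n) *\<^sub>R e n" for n
  proof -
    have "F (e n) = 0"
      using E(3) by (intro F_0 cinner_eq_0_sym[OF MD(1)]) blast
    then show ?thesis
      using e(3)[of n] by (simp add: K_def l_def algebra_simps)
  qed
  have K_Z: "K z = 0" if "z \<in> Z" for z
  proof -
    have "F z = 0"
      using E(3) by (intro F_0 cinner_eq_0_sym[OF MD(2)[OF _ that]]) blast
    then show ?thesis
      using that by (simp add: K_def Z_def)
  qed
  have dense: "closure (complex_vector.span (range e \<union> (Z \<union> M))) = UNIV"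
  proof (rule closure_span_eq_UNIV)
    fix x
    assume x: "\<And>s. s \<in> range e \<union> (Z \<union> M) \<Longrightarrow> cinner x s = 0"
    then have "x \<in> M"
      unfolding M_def by blast
    then have "cinner x x = 0"
      using x by blast
    then show "x = 0"
      by simp
  qed
  have ZM: "cinner y v = 0" if "y \<in> Z \<union> M" "v \<in> range e" for y v
    using that by (auto simp: Z_def M_def)

  define \<kappa> where "\<kappa> v = \<alpha> - norm (T v)" for v
  have K_bounds: "norm (K x) \<le> \<alpha> * norm x" "0 \<le> Re (cinner (K x) x)" for x
    by (rule diagonal_bounds[OF K_clin e(1) _ _ _ \<open>0 \<le> \<alpha>\<close> _ ZM dense, where \<gamma> = \<kappa>];
        use K_e K_Z K_M \<alpha>(2) in \<open>auto simp: \<kappa>_def l_def\<close>)+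
  define S where "S n = diag_op (e ` {..<n}) \<kappa>" for n
  have eI: "orthonormal (e ` {..<n})" "finite (e ` {..<n})" for n
    using e(1) by (auto intro: orthonormal_subset)
  \<comment> \<open>\<open>K - S n\<close> is again diagonal, with the first \<open>n\<close>
    eigenvalues replaced by 0. The others are \<open>\<alpha> - l k\<close> with
    \<open>k \<ge> n\<close>, at most \<open>\<alpha> - l n\<close> by monotonicity.\<close>
  have S_bound: "norm (K x - S n x) \<le> (\<alpha> - l n) * norm x" for n x
  proof (rule diagonal_bounds(1)[OF _ e(1) _ _ _ _ _ ZM dense,
        where \<gamma> = "\<lambda>v. if v \<in> e ` {..<n} then 0 else \<kappa> v"])
    show "bounded_clinear (\<lambda>x. K x - S n x)"
      unfolding S_def by (intro bounded_clinear_diff_op K_clin bounded_clinear_diag_op)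
    show "0 \<le> \<alpha> - l n"
      using \<alpha>(2)[of n] by simp
    show "K y - S n y = 0" if "y \<in> Z \<union> M" for y
    proof -
      have "S n y = 0"
        unfolding S_def using ZM[OF that] by (intro diag_op_orthogonal) auto
      then show ?thesis
        using that K_Z K_M by auto
    qed
    fix v
    assume "v \<in> range e"
    then obtain k where v: "v = e k"
      by blast
    have mem: "v \<in> e ` {..<n} \<longleftrightarrow> k < n"
      using e(2) by (auto simp: v inj_eq)
    show "K v - S n v = (if v \<in> e ` {..<n} then 0 else \<kappa> v) *\<^sub>R v"
    proof (cases "k < n")
      case True
      then have "S n v = \<kappa> v *\<^sub>R v"
        unfolding S_def using mem by (intro diag_op_eigenvector eI) simp
      then show ?thesis
        using True mem by (simp add: v K_e \<kappa>_def l_def)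
    next
      case False
      then have "S n v = 0"
        unfolding S_def by (intro diag_op_orthogonal) (auto simp: v intro!: e_orth)
      then show ?thesis
        using False mem by (simp add: v K_e \<kappa>_def l_def)
    qed
    show "0 \<le> (if v \<in> e ` {..<n} then 0 else \<kappa> v)"
      using \<alpha>(2)[of k] by (simp add: \<kappa>_def v l_def)
    show "(if v \<in> e ` {..<n} then 0 else \<kappa> v) \<le> \<alpha> - l n"
      using mem \<alpha>(2)[of n] incseqD[OF \<open>incseq l\<close>, of n k] by (auto simp: \<kappa>_def v l_def)
  qed
  have "compact_op K"
  proof (rule compact_op_limit[OF K_clin _ S_bound])
    show "compact_op (S n)" for n
      unfolding S_def using \<alpha>(2) l_nonneg
      by (intro compact_diag_op[OF eI, where C = \<alpha>]) (auto simp: \<kappa>_def l_def)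
    show "(\<lambda>n. \<alpha> - l n) \<longlonglongrightarrow> 0"
      using tendsto_diff[OF tendsto_const \<alpha>(1), of \<alpha>] by simp
  qed
  moreover have "positive_op K"
    by (rule positive_opI[OF K_clin K_sa K_bounds(2)])
  moreover have "onorm K \<le> \<alpha>"
    by (rule onorm_bound[OF \<open>0 \<le> \<alpha>\<close> K_bounds(1)])
  moreover have "positive_op F"
    unfolding F_def using E_gap by (intro positive_diag_op) (simp add: less_imp_le)
  moreover have "finite_rank_op F"
    unfolding F_def using E_gap by (intro finite_rank_diag_op E) fastforce
  moreover have KF: "K (F x) = 0" for x
  proof -
    have "F x \<in> complex_vector.span E"
      unfolding F_def diag_op_def
      by (intro complex_vector.span_sum complex_vector.span_scale complex_vector.span_base)
    then show ?thesis
      using K_M E(5) by simp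
  qed
  \<comment> \<open>\<open>F K\<close> is the adjoint of \<open>K F\<close>.\<close>
  moreover have "F (K x) = 0" for x
  proof -
    have "cinner (F (K x)) (F (K x)) = 0"
      by (simp add: F_sa[of "K x"] K_sa[of x] KF)
    then show ?thesis by simp
  qed
  moreover have "T x = \<alpha> *\<^sub>R x - K x + F x" for x
    by (simp add: K_def)
  ultimately have "AM_decomposition T \<alpha> K F"
    unfolding AM_decomposition_def using \<open>0 \<le> \<alpha>\<close> by blast
  then show ?thesis by blast
qed

section \<open>Uniqueness and types\<close>

lemma AM_decompositionD:
  assumes "AM_decomposition T \<alpha> K F"
  shows "0 \<le> \<alpha>" "positive_op K" "compact_op K" "onorm K \<le> \<alpha>" "positive_op F" "finite_rank_op F"
    "K (F x) = 0" "F (K x) = 0" "T x = \<alpha> *\<^sub>R x - K x + F x"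
  using assms by (simp_all add: AM_decomposition_def)

lemma AM_decomposition_compact_diff:
  "AM_decomposition T \<alpha> K F \<Longrightarrow> compact_op (\<lambda>x. K x - F x)"
  by (rule compact_op_diff[OF AM_decompositionD(3) compact_op_finite_rank[OF AM_decompositionD(6)]])

text \<open>\<open>K\<close> and \<open>F\<close> behave as the positive and negative parts of
  \<open>\<alpha> I - T\<close>. Applying each to \<open>K v - F v = (\<alpha> - a) v\<close> gives
  \<open>K (K v) = (\<alpha> - a) K v\<close> and \<open>F (F v) = - (\<alpha> - a) F v\<close>;
  positivity annihilates the part whose factor has the wrong sign.\<close>

lemma AM_decomposition_eigenvector:
  fixes a :: real
  assumes D: "AM_decomposition T \<alpha> K F" and v: "T v = a *\<^sub>R v"
  shows "K v = max 0 (\<alpha> - a) *\<^sub>R v"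
proof -
  note K = positive_opD[OF AM_decompositionD(2)[OF D]]
    and F = positive_opD[OF AM_decompositionD(5)[OF D]]
    and KF = AM_decompositionD(7,8)[OF D]
  have C: "K v - F v = (\<alpha> - a) *\<^sub>R v"
    using v AM_decompositionD(9)[OF D, of v] by (simp add: algebra_simps)
  have "K (K v - F v) = (\<alpha> - a) *\<^sub>R K v" "F (K v - F v) = (\<alpha> - a) *\<^sub>R F v"
    unfolding C by (rule bounded_clinear_scaleR[OF K(1)], rule bounded_clinear_scaleR[OF F(1)])
  then have KK: "K (K v) = (\<alpha> - a) *\<^sub>R K v" and "- F (F v) = (\<alpha> - a) *\<^sub>R F v"
    by (simp_all add: bounded_clinear_diff[OF K(1)] bounded_clinear_diff[OF F(1)] KF)
  then have FF: "F (F v) = - ((\<alpha> - a) *\<^sub>R F v)"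
    by (metis minus_minus)
  show ?thesis
  proof (cases "a < \<alpha>")
    case True
    have "(norm (F v))\<^sup>2 = Re (cinner (F (F v)) v)"
      by (simp only: norm_square_Re_cinner F(2)[of "F v" v])
    also have "\<dots> = - ((\<alpha> - a) * Re (cinner (F v) v))"
      unfolding FF cinner_scaleR_left cinner_minus_left by simp
    finally have "(norm (F v))\<^sup>2 \<le> 0"
      using True F(3)[of v] by simp
    then show ?thesis
      using C True by simp
  next
    case False
    have "(norm (K v))\<^sup>2 = Re (cinner (K (K v)) v)"
      by (simp only: norm_square_Re_cinner K(2)[of "K v" v])
    also have "\<dots> = (\<alpha> - a) * Re (cinner (K v) v)"
      unfolding KK cinner_scaleR_left by simp
    also have "\<dots> \<le> 0"
      using False K(3)[of v] by (intro mult_nonpos_nonneg) auto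
    finally show ?thesis
      using False by simp
  qed
qed

text \<open>Subtracting two decompositions exhibits \<open>(\<alpha> - \<beta>) I\<close> as a
  compact operator.\<close>

lemma AM_decomposition_scalar_unique:
  fixes T :: "'a::chilbert_space \<Rightarrow> 'a"
  assumes inf: "\<not> finite_cdim (UNIV :: 'a set)" and T: "T \<in> AM_plus"
    and D: "AM_decomposition T \<alpha> K F" and D': "AM_decomposition T \<beta> K' F'"
  shows "\<alpha> = \<beta>"
proof -
  have "compact_op (\<lambda>x. (K x - F x) - (K' x - F' x))"
    using D D' by (intro compact_op_diff[of "\<lambda>x. K x - F x"] AM_decomposition_compact_diff)
  moreover have "(K x - F x) - (K' x - F' x) = of_real (\<alpha> - \<beta>) *\<^sub>C x" for x
    using AM_decompositionD(9)[OF D, of x] AM_decompositionD(9)[OF D', of x]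
    by (simp add: algebra_simps flip: scaleR_scaleC)
  ultimately have "complex_of_real (\<alpha> - \<beta>) = 0"
    by (intro compact_op_scalar_on_infinite_dim[OF T closed_csubspace_UNIV _ inf]) auto
  then show ?thesis
    by simp
qed

lemma AM_decomposition_unique:
  fixes T :: "'a::chilbert_space \<Rightarrow> 'a"
  assumes inf: "\<not> finite_cdim (UNIV :: 'a set)" and T: "T \<in> AM_plus"
    and D: "AM_decomposition T \<alpha> K F" and D': "AM_decomposition T \<beta> K' F'"
  shows "\<alpha> = \<beta> \<and> K = K' \<and> F = F'"
proof -
  have eq: "\<alpha> = \<beta>"
    by (rule AM_decomposition_scalar_unique[OF inf T D D'])
  have "closed_csubspace (null_space (\<lambda>x. K x - K' x))"
    using D D'
    by (intro closed_csubspace_null_space bounded_clinear_diff_op compact_op_bounded_clinear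
        AM_decompositionD(3))
  moreover have "{v. \<exists>a::real. T v = a *\<^sub>R v} \<subseteq> null_space (\<lambda>x. K x - K' x)"
  proof safe
    fix v and a :: real
    assume v: "T v = a *\<^sub>R v"
    show "v \<in> null_space (\<lambda>x. K x - K' x)"
      using AM_decomposition_eigenvector[OF D v] AM_decomposition_eigenvector[OF D' v]
      by (simp add: null_space_def eq)
  qed
  ultimately have "UNIV \<subseteq> null_space (\<lambda>x. K x - K' x)"
    unfolding eigenvectors_total[OF T, symmetric] by (intro closure_span_minimal)
  then have "K = K'"
    by (auto simp: null_space_def)
  moreover from this have "F = F'"
    using AM_decompositionD(9)[OF D] AM_decompositionD(9)[OF D'] eq
    by (metis add_left_cancel ext)
  ultimately show ?thesis
    using eq by simp
qed

text \<open>On the eigenspace of \<open>l\<close> the compact operator \<open>K - F\<close> acts as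
  the scalar \<open>\<alpha> - l\<close>, so infinite multiplicity forces
  \<open>l = \<alpha>\<close>; and the eigenspace of \<alpha> is the null space of
  \<open>K - F\<close>.\<close>

lemma inf_mult_eigenvalue_iff:
  fixes T :: "'a::chilbert_space \<Rightarrow> 'a"
  assumes T: "T \<in> AM_plus" and D: "AM_decomposition T \<alpha> K F"
  shows "inf_mult_eigenvalue T l \<longleftrightarrow>
    l = of_real \<alpha> \<and> \<not> finite_cdim (null_space (\<lambda>x. K x - F x))"
proof -
  note pos = positive_opD[OF AM_plusD(1)[OF T]]
  have C: "K x - F x = \<alpha> *\<^sub>R x - T x" for x
    using AM_decompositionD(9)[OF D, of x] by simp
  have null_eq: "null_space (\<lambda>x. T x - of_real \<alpha> *\<^sub>C x) = null_space (\<lambda>x. K x - F x)"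
    by (auto simp: null_space_def C simp flip: scaleR_scaleC)
  have "l = of_real \<alpha>" if "inf_mult_eigenvalue T l"
  proof -
    let ?V = "null_space (\<lambda>x. T x - l *\<^sub>C x)"
    have inf: "\<not> finite_cdim ?V"
      using that by (simp add: inf_mult_eigenvalue_def)
    have V: "closed_csubspace ?V"
      by (intro closed_csubspace_null_space bounded_clinear_diff_op bounded_clinear_scaleC_id pos(1))
    have inv: "T ` ?V \<subseteq> ?V"
      by (auto simp: null_space_def bounded_clinear_scaleC[OF pos(1)])
    have "K x - F x = (of_real \<alpha> - l) *\<^sub>C x" if "x \<in> ?V" for x
      using that
      by (simp add: C null_space_def scaleR_scaleC complex_vector.scale_left_diff_distrib)
    then have "of_real \<alpha> - l = 0"
      by (rule compact_op_scalar_on_infinite_dim[OF T V inv inf AM_decomposition_compact_diff[OF D]])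
    then show ?thesis
      by simp
  qed
  moreover have "inf_mult_eigenvalue T (of_real \<alpha>)" if "\<not> finite_cdim (null_space (\<lambda>x. K x - F x))"
  proof -
    have "finite_cdim ({0} :: 'a set)"
      unfolding finite_cdim_def by (rule exI[of _ "{}"]) simp
    then have "null_space (\<lambda>x. K x - F x) \<noteq> {0}"
      using that by metis
    moreover have "0 \<in> null_space (\<lambda>x. K x - F x)"
      by (simp add: null_space_def C bounded_clinear_zero[OF pos(1)])
    ultimately obtain x where "x \<noteq> 0" "x \<in> null_space (\<lambda>x. K x - F x)"
      by blast
    then have "eigenvalue T (of_real \<alpha>)"
      unfolding eigenvalue_def null_eq[symmetric] by (auto simp: null_space_def)
    then show ?thesis
      using that by (simp add: inf_mult_eigenvalue_def null_eq)
  qed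
  ultimately show ?thesis
    using null_eq by (auto simp: inf_mult_eigenvalue_def)
qed

section \<open>The converse\<close>

text \<open>The form \<open>q x = (norm (T x))^2 - \<mu>^2 * (norm x)^2\<close> is nonnegative on
  \<open>M\<close>, so the parallelogram law bounds \<open>q\<close> of a difference by
  \<open>2 * q\<close> of each term, which tends to 0. Up to a term controlled by \<open>C\<close>,
  \<open>q d\<close> is at least \<open>(\<alpha>^2 - \<mu>^2) * (norm d)^2\<close>, and compactness
  makes that term small along a subsequence.\<close>

lemma min_attaining_below_scalar:
  fixes T :: "'a::chilbert_space \<Rightarrow> 'a"
  assumes T: "bounded_clinear T" and C: "compact_op C" "\<And>x. T x = \<alpha> *\<^sub>R x - C x"
    and M: "closed_csubspace M" "M \<noteq> {0}" and less: "min_modulus M T < \<alpha>"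
  shows "min_attaining M T"
proof -
  define \<mu> where "\<mu> = min_modulus M T"
  have \<mu>: "0 \<le> \<mu>" "\<mu> < \<alpha>"
    using min_modulus_nonneg[OF M] less by (simp_all add: \<mu>_def)
  have bdd: "bdd_below ((\<lambda>x. norm (T x)) ` {x \<in> M. norm x = 1})"
    by (rule bdd_belowI[of _ 0]) auto
  have ne: "{x \<in> M. norm x = 1} \<noteq> {}"
    by (rule unit_sphere_nonempty[OF M])
  have "\<exists>x. x \<in> M \<and> norm x = 1 \<and> norm (T x) < \<mu> + 1 / real (Suc n)" for n
    using cINF_less_iff[OF ne bdd, of "\<mu> + 1 / real (Suc n)"]
    by (auto simp: \<mu>_def min_modulus_def)
  then obtain y where y: "\<And>n. y n \<in> M" "\<And>n. norm (y n) = 1"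
      "\<And>n. norm (T (y n)) < \<mu> + 1 / real (Suc n)"
    by metis
  obtain r l where r: "strict_mono (r :: nat \<Rightarrow> nat)" "(\<lambda>n. C (y (r n))) \<longlonglongrightarrow> l"
    using compact_op_convergent_subseq[OF C(1)] y(2) by (metis order_refl)
  define x where "x n = y (r n)" for n
  have x: "x n \<in> M" "norm (x n) = 1" for n
    using y by (simp_all add: x_def)
  have \<mu>_le: "\<mu> * norm z \<le> norm (T z)" if "z \<in> M" for z
    unfolding \<mu>_def by (rule min_modulus_mult_le[OF T M(1) that])
  have Tx_lim: "(\<lambda>n. norm (T (x n))) \<longlonglongrightarrow> \<mu>"
  proof (rule tendsto_sandwich)
    show "\<forall>\<^sub>F n in sequentially. \<mu> \<le> norm (T (x n))"
      using \<mu>_le[OF x(1)] x(2) by simp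
    have "norm (T (x n)) \<le> \<mu> + inverse (real (Suc n))" for n
    proof -
      have "1 / real (Suc (r n)) \<le> 1 / real (Suc n)"
        using seq_suble[OF r(1), of n] by (intro divide_left_mono) auto
      then show ?thesis
        using y(3)[of "r n"] by (simp add: x_def inverse_eq_divide)
    qed
    then show "\<forall>\<^sub>F n in sequentially. norm (T (x n)) \<le> \<mu> + inverse (real (Suc n))"
      by simp
    show "(\<lambda>n. \<mu> + inverse (real (Suc n))) \<longlonglongrightarrow> \<mu>"
      using tendsto_add[OF tendsto_const LIMSEQ_inverse_real_of_nat, of \<mu>] by simp
  qed simp
  define s where "s n = (norm (T (x n)))\<^sup>2 - \<mu>\<^sup>2" for n
  have s_lim: "s \<longlonglongrightarrow> 0"
    using tendsto_diff[OF tendsto_power[OF Tx_lim, of 2] tendsto_const, of "\<mu>\<^sup>2"]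
    unfolding s_def by simp
  \<comment> \<open>The term \<open>2 * s n\<close> comes from the parallelogram law, and
    \<open>4 * \<alpha>\<close> is the coefficient \<open>2 * \<alpha>\<close> of the cross term
    times the bound \<open>norm d \<le> 2\<close>.\<close>
  define b where "b n = (2 * s n + 4 * \<alpha> * norm (C (x n) - l)) / (\<alpha>\<^sup>2 - \<mu>\<^sup>2)" for n
  have gap: "0 < \<alpha>\<^sup>2 - \<mu>\<^sup>2"
    using \<mu> power_strict_mono[of \<mu> \<alpha> 2] by simp
  have "Cauchy x"
  proof (rule Cauchy_if_norm_diff_square_le)
    have "(\<lambda>n. norm (C (x n) - l)) \<longlonglongrightarrow> 0"
      using tendsto_norm_zero[OF LIM_zero[OF r(2)]] by (simp add: x_def)
    then have "b \<longlonglongrightarrow> (2 * 0 + 4 * \<alpha> * 0) / (\<alpha>\<^sup>2 - \<mu>\<^sup>2)"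
      unfolding b_def using s_lim gap by (intro tendsto_intros) auto
    then show "b \<longlonglongrightarrow> 0"
      by simp
    fix m n
    define d where "d = x m - x n"
    have Td: "T d = \<alpha> *\<^sub>R d - C d"
      by (rule C(2))
    have d2: "norm d \<le> 2"
      using norm_triangle_ineq4[of "x m" "x n"] x(2) by (simp add: d_def)
    have "norm (C d) \<le> norm (C (x m) - l) + norm (C (x n) - l)"
      using norm_triangle_ineq4[of "C (x m) - l" "C (x n) - l"]
      by (simp add: d_def bounded_clinear_diff[OF compact_op_bounded_clinear[OF C(1)]])
    then have "norm d * norm (C d) \<le> 2 * (norm (C (x m) - l) + norm (C (x n) - l))"
      using d2 by (intro mult_mono) auto
    then have Cd: "2 * \<alpha> * (norm d * norm (C d)) \<le>
        2 * \<alpha> * (2 * (norm (C (x m) - l) + norm (C (x n) - l)))"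
      using \<mu> by (intro mult_left_mono) auto
    have "Re (cinner d (C d)) \<le> norm d * norm (C d)"
      using cinner_Cauchy_Schwarz complex_Re_le_cmod order_trans by blast
    then have "2 * \<alpha> * Re (cinner d (C d)) \<le> 2 * \<alpha> * (norm d * norm (C d))"
      using \<mu> by (intro mult_left_mono) auto
    moreover have "(norm (T d))\<^sup>2 =
        \<alpha>\<^sup>2 * (norm d)\<^sup>2 - 2 * \<alpha> * Re (cinner d (C d)) + (norm (C d))\<^sup>2"
      by (simp add: Td norm_diff_square cinner_scaleR_left power_mult_distrib)
    ultimately have Td_low: "\<alpha>\<^sup>2 * (norm d)\<^sup>2 - 2 * \<alpha> * (norm d * norm (C d)) \<le> (norm (T d))\<^sup>2"
      using zero_le_power2[of "norm (C d)"] by linarith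
    have "(\<mu> * norm (x m + x n))\<^sup>2 \<le> (norm (T (x m + x n)))\<^sup>2"
      using \<mu>(1) x(1) by (intro power_mono \<mu>_le closed_csubspaceD[OF M(1)]) auto
    moreover have "(norm (T (x m + x n)))\<^sup>2 + (norm (T d))\<^sup>2 =
        2 * (norm (T (x m)))\<^sup>2 + 2 * (norm (T (x n)))\<^sup>2"
      using parallelogram_law[of "T (x m)" "T (x n)"]
      by (simp add: d_def bounded_clinear_add[OF T] bounded_clinear_diff[OF T])
    moreover have "(norm (x m + x n))\<^sup>2 = 4 - (norm d)\<^sup>2"
      using parallelogram_law[of "x m" "x n"] x(2) by (simp add: d_def)
    ultimately have "(norm (T d))\<^sup>2 - \<mu>\<^sup>2 * (norm d)\<^sup>2 \<le> 2 * s m + 2 * s n"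
      by (simp add: s_def power_mult_distrib algebra_simps)
    with Td_low Cd have "(\<alpha>\<^sup>2 - \<mu>\<^sup>2) * (norm d)\<^sup>2 \<le>
        (2 * s m + 4 * \<alpha> * norm (C (x m) - l)) + (2 * s n + 4 * \<alpha> * norm (C (x n) - l))"
      by (simp add: algebra_simps)
    then show "(norm (x m - x n))\<^sup>2 \<le> b m + b n"
      using gap unfolding b_def d_def[symmetric]
      by (simp add: pos_le_divide_eq mult.commute flip: add_divide_distrib)
  qed
  then obtain z where z: "x \<longlonglongrightarrow> z"
    by (auto simp: Cauchy_convergent_iff convergent_def)
  have "z \<in> M"
    using closed_csubspaceD(6)[OF M(1)] x(1) z by (rule closed_sequentially)
  moreover have "norm z = 1"
    using LIMSEQ_unique[OF tendsto_norm[OF z]] x(2) by simp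
  moreover have "norm (T z) = \<mu>"
    using LIMSEQ_unique[OF tendsto_norm[OF bounded_clinear_tendsto[OF T z]] Tx_lim] .
  ultimately show ?thesis
    unfolding min_attaining_def \<mu>_def by blast
qed

section \<open>Finite dimensional subspaces and finite rank\<close>

lemma min_attaining_finite_cdim:
  assumes T: "bounded_clinear T" and M: "closed_csubspace M" "M \<noteq> {0}" and fin: "finite_cdim M"
  shows "min_attaining M T"
proof -
  obtain Q where Q: "compact Q" "M \<inter> cball 0 1 \<subseteq> Q" "Q \<subseteq> M"
    using finite_cdim_bounded_subset_compact[OF fin] .
  have "{x \<in> M. norm x = 1} = Q \<inter> {x. norm x = 1}"
    using Q(2,3) by auto
  then have "compact {x \<in> M. norm x = 1}"
    using Q(1) by (simp add: compact_Int_closed closed_Collect_eq continuous_intros)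
  moreover have "{x \<in> M. norm x = 1} \<noteq> {}"
    by (rule unit_sphere_nonempty[OF M])
  moreover have "continuous_on {x \<in> M. norm x = 1} (\<lambda>x. norm (T x))"
    by (intro continuous_intros bounded_clinear_continuous_on[OF T])
  ultimately obtain x where x: "x \<in> M" "norm x = 1"
    "\<And>y. y \<in> M \<Longrightarrow> norm y = 1 \<Longrightarrow> norm (T x) \<le> norm (T y)"
    using continuous_attains_inf[of "{x \<in> M. norm x = 1}" "\<lambda>x. norm (T x)"] by auto
  have "norm (T x) \<le> min_modulus M T"
    unfolding min_modulus_def using x by (intro cINF_greatest unit_sphere_nonempty[OF M]) auto
  with T x(1,2) show ?thesis
    by (intro min_attainingI)
qed

lemma finite_cdim_subspace:
  fixes S :: "'a::complex_vector set"
  assumes "complex_vector.subspace S" "S \<subseteq> R" "finite_cdim R"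
  shows "finite_cdim S"
proof -
  obtain B where B: "finite B" "complex_vector.span B = R"
    using assms(3) by (auto simp: finite_cdim_def)
  obtain D where D: "D \<subseteq> S" "complex_vector.independent D" "S \<subseteq> complex_vector.span D"
    using complex_vector.maximal_independent_subset by blast
  have "finite D"
    using complex_vector.independent_span_bound[OF B(1) D(2)] D(1) assms(2) B(2) by blast
  moreover have "complex_vector.span D = S"
    by (rule complex_vector.span_subspace[OF D(1,3) assms(1)])
  ultimately show ?thesis
    by (auto simp: finite_cdim_def)
qed

lemma csubspace_image:
  assumes F: "bounded_clinear F" and M: "complex_vector.subspace M"
  shows "complex_vector.subspace (F ` M)"
proof (rule complex_vector.subspaceI)
  show "0 \<in> F ` M"
    using complex_vector.subspace_0[OF M]
    by (rule rev_image_eqI) (simp add: bounded_clinear_zero[OF F])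
  fix x c
  assume "x \<in> F ` M"
  then obtain u where u: "u \<in> M" "x = F u"
    by (rule imageE)
  show "c *\<^sub>C x \<in> F ` M"
    using complex_vector.subspace_scale[OF M u(1), of c]
    by (rule rev_image_eqI) (simp add: u bounded_clinear_scaleC[OF F])
  fix y
  assume "y \<in> F ` M"
  then obtain w where w: "w \<in> M" "y = F w"
    by (rule imageE)
  show "x + y \<in> F ` M"
    using complex_vector.subspace_add[OF M u(1) w(1)]
    by (rule rev_image_eqI) (simp add: u w bounded_clinear_add[OF F])
qed

lemma finite_cdim_if_inj_finite_rank:
  fixes F :: "'a::chilbert_space \<Rightarrow> 'b::chilbert_space"
  assumes F: "finite_rank_op F" and M: "closed_csubspace M" and inj: "M \<inter> null_space F = {0}"
  shows "finite_cdim M"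
proof -
  have clin: "bounded_clinear F"
    using F by (simp add: finite_rank_op_def)
  have "complex_vector.subspace (F ` M)"
    using clin M by (intro csubspace_image) (simp_all add: closed_csubspace_def)
  then have "finite_cdim (F ` M)"
    by (rule finite_cdim_subspace[of _ "range F"]) (use F in \<open>auto simp: finite_rank_op_def\<close>)
  then obtain B where B: "finite B" "complex_vector.span B = F ` M"
    by (auto simp: finite_cdim_def)
  have "B \<subseteq> F ` M"
    using B(2) complex_vector.span_superset by blast
  then obtain D where D: "D \<subseteq> M" "finite D" "B = F ` D"
    using finite_subset_image[OF B(1)] by metis
  have sub: "complex_vector.span D \<subseteq> M"
    using D(1) M by (intro complex_vector.span_minimal) (auto simp: closed_csubspace_def)
  have "x \<in> complex_vector.span D" if "x \<in> M" for x
  proof -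
    have "complex_vector.span (F ` D) \<subseteq> F ` complex_vector.span D"
    proof (rule complex_vector.span_minimal)
      show "F ` D \<subseteq> F ` complex_vector.span D"
        by (intro image_mono complex_vector.span_superset)
      show "complex_vector.subspace (F ` complex_vector.span D)"
        by (intro csubspace_image clin complex_vector.subspace_span)
    qed
    moreover have "F x \<in> complex_vector.span (F ` D)"
      using that B(2) D(3) by auto
    ultimately obtain y where y: "y \<in> complex_vector.span D" "F x = F y"
      by blast
    have "x - y \<in> M \<inter> null_space F"
      using that y sub closed_csubspaceD(3)[OF M]
      by (auto simp: null_space_def bounded_clinear_diff[OF clin])
    with inj y(1) show ?thesis
      by simp
  qed
  with sub have "complex_vector.span D = M"
    by blast
  with D(2) show ?thesis
    by (auto simp: finite_cdim_def)
qed

text \<open>The operator inequality \<open>K^2 \<le> \<alpha> K\<close>, obtained without a square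
  root of \<open>K\<close> by testing positivity on one suitable vector.\<close>

lemma positive_op_norm_square_le:
  assumes K: "positive_op K" and "onorm K \<le> \<alpha>"
  shows "(norm (K x))\<^sup>2 \<le> \<alpha> * Re (cinner (K x) x)"
proof -
  note K' = positive_opD[OF K]
  have norm_le: "norm (K z) \<le> \<alpha> * norm z" for z
    using onorm[OF bounded_clinear_bounded_linear[OF K'(1)], of z] assms(2)
    by (meson mult_right_mono norm_ge_zero order_trans)
  show ?thesis
  proof (cases "\<alpha> \<le> 0")
    case True
    then have "norm (K x) \<le> 0"
      using norm_le[of x] mult_nonpos_nonneg[of \<alpha> "norm x"] norm_ge_zero[of x] by linarith
    then have "K x = 0"
      by simp
    then show ?thesis by simp
  next
    case False
    \<comment> \<open>Expanding \<open>cinner (K z) z\<close> leaves a cubic term in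
      \<open>K\<close>, at most \<open>\<alpha> * (norm (K x))^2\<close>. It absorbs half of the
      cross term, and division by \<alpha> gives the claim.\<close>
    define z where "z = \<alpha> *\<^sub>R x - K x"
    have "Re (cinner (K (K x)) (K x)) \<le> norm (K (K x)) * norm (K x)"
      using cinner_Cauchy_Schwarz complex_Re_le_cmod order_trans by blast
    also have "\<dots> \<le> (\<alpha> * norm (K x)) * norm (K x)"
      by (intro mult_right_mono norm_le) simp
    finally have "Re (cinner (K (K x)) (K x)) \<le> \<alpha> * (norm (K x))\<^sup>2"
      by (simp add: power2_eq_square)
    moreover have "Re (cinner (K z) z) = \<alpha> * (\<alpha> * Re (cinner (K x) x))
        - 2 * (\<alpha> * Re (cinner (K x) (K x))) + Re (cinner (K (K x)) (K x))"
      using K'(2)[of "K x" x]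
      by (simp add: z_def bounded_clinear_diff[OF K'(1)] bounded_clinear_scaleR[OF K'(1)]
          cinner_diff_left cinner_diff_right cinner_scaleR_left cinner_scaleR_right algebra_simps)
    ultimately have "0 \<le> \<alpha> * (\<alpha> * Re (cinner (K x) x) - (norm (K x))\<^sup>2)"
      using K'(3)[of z] by (simp add: norm_square_Re_cinner algebra_simps)
    then show ?thesis
      using False by (simp add: zero_le_mult_iff)
  qed
qed

lemma AM_plus_if_AM_decomposition:
  fixes T :: "'a::chilbert_space \<Rightarrow> 'a"
  assumes T: "bounded_clinear T" and D: "AM_decomposition T \<alpha> K F"
  shows "T \<in> AM_plus"
proof -
  note K = positive_opD[OF AM_decompositionD(2)[OF D]]
    and F = positive_opD[OF AM_decompositionD(5)[OF D]]
    and T_eq = AM_decompositionD(9)[OF D]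
  have K_norm: "norm (K x) \<le> \<alpha> * norm x" for x
    using onorm[OF bounded_clinear_bounded_linear[OF K(1)], of x] AM_decompositionD(4)[OF D]
    by (meson mult_right_mono norm_ge_zero order_trans)
  have "positive_op T"
  proof (rule positive_opI[OF T])
    show "cinner (T x) y = cinner x (T y)" for x y
      by (simp add: T_eq cinner_simps K(2) F(2))
    fix x
    have "Re (cinner (K x) x) \<le> norm (K x) * norm x"
      using cinner_Cauchy_Schwarz complex_Re_le_cmod order_trans by blast
    also have "\<dots> \<le> (\<alpha> * norm x) * norm x"
      by (intro mult_right_mono K_norm) simp
    also have "\<dots> = Re (cinner (\<alpha> *\<^sub>R x) x)"
      by (simp add: cinner_scaleR_left cinner_norm power2_eq_square)
    finally show "0 \<le> Re (cinner (T x) x)"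
      using F(3)[of x] by (simp add: T_eq cinner_add_left cinner_diff_left)
  qed
  moreover have "min_attaining M T" if M: "closed_csubspace M" "M \<noteq> {0}" for M
  proof (cases "min_modulus M T < \<alpha>")
    case True
    have "T x = \<alpha> *\<^sub>R x - (K x - F x)" for x
      by (simp add: T_eq)
    then show ?thesis
      by (rule min_attaining_below_scalar[OF T AM_decomposition_compact_diff[OF D] _ M True])
  next
    case False
    show ?thesis
    proof (cases "M \<inter> null_space F = {0}")
      case True
      then have "finite_cdim M"
        by (rule finite_cdim_if_inj_finite_rank[OF AM_decompositionD(6)[OF D] M(1)])
      then show ?thesis
        by (rule min_attaining_finite_cdim[OF T M])
    next
      case nonzero: False
      obtain x where x: "x \<in> M \<inter> null_space F" "norm x = 1"
        by (rule unit_vector_exists[OF closed_csubspace_Int[OF M(1)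
                closed_csubspace_null_space[OF F(1)]] nonzero])
      \<comment> \<open>\<open>F x = 0\<close> reduces \<open>T x\<close> to
        \<open>\<alpha> x - K x\<close>, and \<open>K^2 \<le> \<alpha> K\<close> lets the cross term
        outweigh \<open>(norm (K x))^2\<close>. Thus \<open>x\<close> stays within the minimum
        modulus, which is at least \<alpha> in this case.\<close>
      have "(norm (T x))\<^sup>2 = \<alpha>\<^sup>2 - 2 * \<alpha> * Re (cinner (K x) x) + (norm (K x))\<^sup>2"
        using x Re_cinner_commute[of x "K x"]
        by (simp add: T_eq null_space_def norm_diff_square cinner_scaleR_left power_mult_distrib)
      also have "\<dots> \<le> \<alpha>\<^sup>2"
        using positive_op_norm_square_le[OF AM_decompositionD(2,4)[OF D], of x]
          mult_nonneg_nonneg[OF AM_decompositionD(1)[OF D] K(3)[of x]] by simp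
      finally have "norm (T x) \<le> \<alpha>"
        using AM_decompositionD(1)[OF D] by (rule power2_le_imp_le)
      then show ?thesis
        using x False by (intro min_attainingI[OF T, of x]) auto
    qed
  qed
  ultimately show ?thesis
    using T by (simp add: AM_plus_def AM_def)
qed

theorem theorem5p10:
  fixes T :: "'a::chilbert_space \<Rightarrow> 'a"
  assumes "\<not> finite_cdim (UNIV :: 'a set)"
    and "bounded_clinear T"
  shows "(T \<in> AM_plus \<longleftrightarrow> (\<exists>!(D :: real \<times> ('a \<Rightarrow> 'a) \<times> ('a \<Rightarrow> 'a)).
             case D of (\<alpha>, K, F) \<Rightarrow> AM_decomposition T \<alpha> K F))
       \<and> (\<forall>\<alpha> K F. T \<in> AM_plus \<and> AM_decomposition T \<alpha> K F \<longrightarrow>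
             (finite_cdim (null_space (\<lambda>x. K x - F x)) \<longrightarrow> first_type T) \<and>
             (\<not> finite_cdim (null_space (\<lambda>x. K x - F x)) \<longrightarrow> second_type T))"
proof (intro conjI iffI allI impI)
  assume T: "T \<in> AM_plus"
  obtain \<alpha> K F where D: "AM_decomposition T \<alpha> K F"
    using AM_decomposition_exists[OF assms(1) T] by blast
  show "\<exists>!(D :: real \<times> ('a \<Rightarrow> 'a) \<times> ('a \<Rightarrow> 'a)). case D of (\<alpha>, K, F) \<Rightarrow> AM_decomposition T \<alpha> K F"
  proof (rule ex1I[of _ "(\<alpha>, K, F)"])
    show "D' = (\<alpha>, K, F)" if "case D' of (\<alpha>, K, F) \<Rightarrow> AM_decomposition T \<alpha> K F"
      for D' :: "real \<times> ('a \<Rightarrow> 'a) \<times> ('a \<Rightarrow> 'a)"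
      using that AM_decomposition_unique[OF assms(1) T _ D] by (cases D') simp
  qed (simp add: D)
next
  assume "\<exists>!(D :: real \<times> ('a \<Rightarrow> 'a) \<times> ('a \<Rightarrow> 'a)). case D of (\<alpha>, K, F) \<Rightarrow> AM_decomposition T \<alpha> K F"
  then show "T \<in> AM_plus"
    using AM_plus_if_AM_decomposition[OF assms(2)] by fast
next
  fix \<alpha> K F
  assume "T \<in> AM_plus \<and> AM_decomposition T \<alpha> K F"
  then have T: "T \<in> AM_plus" and "AM_decomposition T \<alpha> K F"
    by auto
  \<comment> \<open>At most the single value \<alpha> has infinite multiplicity, so both types can
    be read off from the dimension of the null space.\<close>
  note iff = inf_mult_eigenvalue_iff[OF this]
  show "first_type T" if "finite_cdim (null_space (\<lambda>x. K x - F x))"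
    using that T by (simp add: first_type_def iff)
  show "second_type T" if "\<not> finite_cdim (null_space (\<lambda>x. K x - F x))"
    using that T by (simp add: second_type_def iff)
qed

end
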